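(* Let $X,Y$ be bounded convex open subsets of $\mathbb{R}^d$, $\mu\in P(X)$, and $\nu\in P(Y)$ absolutely continuous with respect to Lebesgue measure with density bounded away from zero on $Y$. Then there exists a subharmonic function $\psi_0$ on $Y$, bounded from below, with $\psi_0\in L^1(Y,d\nu)$, such that $$\mathcal{D}_2(\mu,\mathrm{P}^{sh}_{\le\nu}):=\sup_{\psi\in\mathcal{A}_{sh}\cap C_b(Y)}\Big\{\int_X Q_2(\psi)\,d\mu-\int_Y\psi\,d\nu\Big\}\le\int_X Q_2(\psi_0)\,d\mu-\int_Y\psi_0\,d\nu.$$ If moreover $\bar\mu$ denotes a minimizer of $\mathcal{T}_2(\mu,\cdot)$ over $\mathrm{P}^{sh}_{\le\nu}$ and $\int_Y\psi_0\,d\bar\mu\le\int_Y\psi_0\,d\nu$, then equality holds, i.e. $\psi_0$ attains $\mathcal{D}_2(\mu,\mathrm{P}^{sh}_{\le\nu})$.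
   Context: Subharmonic on an open $U$: upper semicontinuous, values in $[-\infty,\infty)$, sub-mean-value inequality over every sphere $\partial B_r(x_0)$ with $B_r(x_0)\subset U$. For $\eta,\xi\in P(Y)$, $\eta\le_{sh}\xi$ means $\int\psi\,d\eta\le\int\psi\,d\xi$ for all subharmonic $\psi\in C_b(Y)$. $\mathcal{A}_{sh}$: subharmonic functions bounded from below. $\mathrm{P}^{sh}_{\le\nu}=\{\eta\in P(Y):\eta\le_{sh}\nu\}$. $Q_2(\psi)(x)=\inf_{y\in Y}\{\psi(y)+|x-y|^2\}$. $\mathcal{T}_2(\alpha,\beta)=\inf_{\pi\in\Pi(\alpha,\beta)}\int|x-y|^2d\pi$. *)

theory Defs
  imports "HOL-Analysis.Analysis" "HOL-Probability.Probability"
begin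

definition usc_on :: "'a::topological_space set \<Rightarrow> ('a \<Rightarrow> real) \<Rightarrow> bool" where
  "usc_on U f \<longleftrightarrow> (\<forall>x\<in>U. \<forall>e>0. \<forall>\<^sub>F y in at x within U. f y < f x + e)"

text \<open>Parametrisation of the sphere of radius r around x0 by the unit ball via radial
  projection; the normalised Lebesgue measure on the unit ball pushed forward by it is the
  normalised surface measure on the sphere.\<close>
definition sphere_fun :: "('a::euclidean_space \<Rightarrow> real) \<Rightarrow> 'a \<Rightarrow> real \<Rightarrow> 'a \<Rightarrow> real" where
  "sphere_fun f x0 r = (\<lambda>x. f (x0 + r *\<^sub>R (x /\<^sub>R norm x)))"

text \<open>Real-valued subharmonic functions on U (the functions in the statement are all bounded
  from below, hence real-valued). The mean over the sphere must exist; a non-integrable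
  (usc, hence bounded above) function has mean value -infinity, violating the inequality.\<close>
definition subharmonic_on :: "'a::euclidean_space set \<Rightarrow> ('a \<Rightarrow> real) \<Rightarrow> bool" where
  "subharmonic_on U f \<longleftrightarrow> usc_on U f \<and>
     (\<forall>x0 r. r > 0 \<and> cball x0 r \<subseteq> U \<longrightarrow>
        set_integrable lborel (ball 0 1) (sphere_fun f x0 r) \<and>
        f x0 \<le> (\<integral>x\<in>ball 0 1. sphere_fun f x0 r x \<partial>lborel) / measure lborel (ball (0::'a) 1))"

definition Cb_on :: "'a::metric_space set \<Rightarrow> ('a \<Rightarrow> real) \<Rightarrow> bool" where
  "Cb_on Y f \<longleftrightarrow> continuous_on Y f \<and> bounded (f ` Y)"

text \<open>Probability measures on X: Borel probability measures on the ambient space concentrated on X.\<close>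
definition P_on :: "'a::euclidean_space set \<Rightarrow> 'a measure \<Rightarrow> bool" where
  "P_on X M \<longleftrightarrow> prob_space M \<and> sets M = sets borel \<and> emeasure M X = 1"

definition sh_le :: "'a::euclidean_space set \<Rightarrow> 'a measure \<Rightarrow> 'a measure \<Rightarrow> bool" where
  "sh_le Y \<eta> \<xi> \<longleftrightarrow> (\<forall>\<psi>. subharmonic_on Y \<psi> \<and> Cb_on Y \<psi> \<longrightarrow>
      (\<integral>y\<in>Y. \<psi> y \<partial>\<eta>) \<le> (\<integral>y\<in>Y. \<psi> y \<partial>\<xi>))"

definition Psh_le :: "'a::euclidean_space set \<Rightarrow> 'a measure \<Rightarrow> 'a measure set" where
  "Psh_le Y \<nu> = {\<eta>. P_on Y \<eta> \<and> sh_le Y \<eta> \<nu>}"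

definition Q2 :: "'a::euclidean_space set \<Rightarrow> ('a \<Rightarrow> real) \<Rightarrow> 'a \<Rightarrow> real" where
  "Q2 Y \<psi> x = (INF y\<in>Y. \<psi> y + (norm (x - y))\<^sup>2)"

definition couplings :: "'a::euclidean_space measure \<Rightarrow> 'a measure \<Rightarrow> ('a \<times> 'a) measure set" where
  "couplings \<alpha> \<beta> = {\<pi>. prob_space \<pi> \<and> sets \<pi> = sets (borel \<Otimes>\<^sub>M borel) \<and>
      distr \<pi> borel fst = \<alpha> \<and> distr \<pi> borel snd = \<beta>}"

definition T2 :: "'a::euclidean_space measure \<Rightarrow> 'a measure \<Rightarrow> ennreal" where
  "T2 \<alpha> \<beta> = (INF \<pi>\<in>couplings \<alpha> \<beta>. \<integral>\<^sup>+ z. ennreal ((norm (fst z - snd z))\<^sup>2) \<partial>\<pi>)"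

definition D2 :: "'a::euclidean_space set \<Rightarrow> 'a::euclidean_space set \<Rightarrow> 'a measure \<Rightarrow> 'a measure \<Rightarrow> ereal" where
  "D2 X Y \<mu> \<nu> = (SUP \<psi>\<in>{\<psi>. subharmonic_on Y \<psi> \<and> Cb_on Y \<psi>}.
      ereal ((\<integral>x\<in>X. Q2 Y \<psi> x \<partial>\<mu>) - (\<integral>y\<in>Y. \<psi> y \<partial>\<nu>)))"

end

theory Submission
  imports Defs "HOL-Complex_Analysis.Great_Picard"
begin

text \<open>A maximising sequence of competitors can be normalised to have infimum \<open>0\<close>; since the density
  of \<open>\<nu>\<close> is bounded below, it is then bounded in Lebesgue \<open>L\<^sup>1\<close> on \<open>Y\<close> and, by the ball mean inequality, locally
  uniformly bounded. Along a subsequence all ball means converge, to \<open>L\<^sub>r\<close> say, and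
  \<open>V = lim L\<^sub>r\<close> as \<open>r\<close> tends to \<open>0\<close> is subharmonic, dominates the pointwise limsup, and satisfies
  \<open>\<integral>V d\<nu> \<le> liminf \<integral>\<psi>\<^sub>n d\<nu>\<close>; reverse Fatou for \<open>Q2\<close> then shows that its dual value \<open>J V\<close> is at least the
  supremum. Finally \<open>t \<mapsto> J (t V)\<close> is continuous on \<open>[0, 1]\<close> and \<open>J 0\<close> is at most the
  supremum, so some \<open>t V\<close> attains it exactly.\<close>

section \<open>Averages over balls and spheres\<close>

text \<open>Adding a constant to a competitor leaves its dual value unchanged, which permits the
  normalisation; close to the supremum, the bound on the transform term then bounds the integral
  against \<nu>, hence the Lebesgue mass. The competitors themselves are not equicontinuous, and a
  pointwise limsup need not be upper semicontinuous. Ball means of fixed radius cure both: moving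
  the centre costs at most the mass in a thin shell, uniformly along the sequence, and the limiting
  means are upper semicontinuous majorants. Since the density may be unbounded, local uniform bounds
  do not control integrals against it; regularity of measures and an induction on the weight give
  the one-sided integral inequality instead. The limit may be neither continuous nor bounded above,
  so it need not be a competitor and its dual value could exceed the supremum: this is what the
  final scaling corrects. Means take values in \<open>ennreal\<close>, where Fubini and Fatou apply
  without integrability conditions.\<close>

lemma nn_integral_lborel_scale:
  fixes F :: "'a::euclidean_space \<Rightarrow> ennreal"
  assumes [measurable]: "F \<in> borel_measurable borel" and c: "c \<noteq> 0"
  shows "(\<integral>\<^sup>+y. F y \<partial>lborel) = ennreal (\<bar>c\<bar> ^ DIM('a)) * (\<integral>\<^sup>+z. F (t + c *\<^sub>R z) \<partial>lborel)"
  by (subst lborel_affine[OF c, of t])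
     (simp add: nn_integral_density nn_integral_distr nn_integral_cmult)

text \<open>\<open>- (1 / u ^ d)\<close> is an antiderivative that vanishes at infinity. This is the
  last one-dimensional integral in \<open>polar_lborel\<close>, where the dilation factors
  \<open>u > norm y\<close> remain.\<close>

lemma nn_integral_inverse_power_tail:
  fixes a :: real
  assumes "a > 0" "d > 0"
  shows "(\<integral>\<^sup>+u. ennreal (real d / u ^ Suc d) * indicator {a<..} u \<partial>lborel) = ennreal (1 / a ^ d)"
proof -
  have "(\<integral>\<^sup>+u. ennreal (real d / u ^ Suc d) * indicator {a<..} u \<partial>lborel)
      = (\<integral>\<^sup>+u. ennreal (real d / u ^ Suc d) * indicator {a..} u \<partial>lborel)"
    by (rule nn_integral_cong_AE, rule AE_mp[OF AE_lborel_singleton[of a]])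
       (auto simp: indicator_def)
  also have "\<dots> = ennreal (0 - (- (1 / a ^ d)))"
  proof (rule nn_integral_FTC_atLeast)
    show "((\<lambda>u::real. - (1 / u ^ d)) \<longlongrightarrow> 0) at_top"
      using tendsto_minus[OF tendsto_inverse_0_at_top[OF filterlim_pow_at_top[OF assms(2) filterlim_ident]]]
      by (simp only: divide_inverse minus_zero mult_1)
    fix u assume "a \<le> u"
    with assms have "u > 0" by simp
    then show "0 \<le> real d / u ^ Suc d" by simp
    have "((\<lambda>u. - (1 / u ^ d)) has_real_derivative real d * u ^ (d - 1) / (u ^ d * u ^ d)) (at u)"
      using \<open>u > 0\<close> by (auto intro!: derivative_eq_intros)
    also have "real d * u ^ (d - 1) / (u ^ d * u ^ d) = real d / u ^ Suc d"
      using \<open>u > 0\<close> assms(2) by (cases d) (simp_all add: field_simps)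
    finally show "((\<lambda>u. - (1 / u ^ d)) has_real_derivative real d / u ^ Suc d) (at u)" .
  qed measurable
  finally show ?thesis by simp
qed

section \<open>Ball means and sphere means over one probability space\<close>

lemma sets_ball_borel [measurable]: "ball (x :: 'a::metric_space) r \<in> sets borel"
  by simp

definition unit_ball_measure :: "'a::euclidean_space measure" where
  "unit_ball_measure = uniform_measure lborel (ball 0 1)"

definition bavg :: "real \<Rightarrow> ('a::euclidean_space \<Rightarrow> ennreal) \<Rightarrow> 'a \<Rightarrow> ennreal" where
  "bavg r f x = (\<integral>\<^sup>+z. f (x + r *\<^sub>R z) \<partial>unit_ball_measure)"

text \<open>Radial projection carries the uniform law on the unit ball to normalised surface
  measure; \<open>sgn 0 = 0\<close> misplaces only a null set. Balls and spheres thus share one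
  probability space, and for nonnegative integrable functions this is the mean built from
  \<open>sphere_fun\<close>.\<close>

definition smean :: "real \<Rightarrow> ('a::euclidean_space \<Rightarrow> ennreal) \<Rightarrow> 'a \<Rightarrow> ennreal" where
  "smean r f x = (\<integral>\<^sup>+z. f (x + r *\<^sub>R sgn z) \<partial>unit_ball_measure)"

lemma unit_ball_emeasure_pos: "emeasure lborel (ball (0::'a::euclidean_space) 1) \<noteq> 0"
  using content_ball_pos[of 1 "0::'a"] by (auto simp: measure_def)

lemma prob_space_unit_ball_measure: "prob_space (unit_ball_measure :: 'a::euclidean_space measure)"
  unfolding unit_ball_measure_def
  by (intro prob_space_uniform_measure unit_ball_emeasure_pos)
     (use emeasure_lborel_ball_finite[of "0::'a" 1] in auto)

lemma sets_unit_ball_measure [simp, measurable_cong]: "sets unit_ball_measure = sets borel"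
  by (simp add: unit_ball_measure_def)

lemma space_unit_ball_measure [simp]: "space unit_ball_measure = UNIV"
  by (simp add: unit_ball_measure_def)

lemma emeasure_unit_ball_measure_UNIV [simp]: "emeasure unit_ball_measure UNIV = 1"
  using prob_space.emeasure_space_1[OF prob_space_unit_ball_measure] by simp

lemma AE_unit_ball_measure: "AE z in unit_ball_measure. z \<in> ball 0 1"
  unfolding unit_ball_measure_def by (rule AE_uniform_measureI) auto

lemma nn_integral_unit_ball_measure:
  fixes f :: "'a::euclidean_space \<Rightarrow> ennreal"
  assumes [measurable]: "f \<in> borel_measurable borel"
  shows "(\<integral>\<^sup>+z. f z \<partial>unit_ball_measure) =
    (\<integral>\<^sup>+z. f z * indicator (ball 0 1) z \<partial>lborel) / emeasure lborel (ball (0::'a) 1)"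
  unfolding unit_ball_measure_def by (rule nn_integral_uniform_measure) auto

lemma measurable_sgn_borel [measurable]:
  "sgn \<in> borel_measurable (borel :: 'a::{second_countable_topology, real_normed_vector} measure)"
  by (simp add: sgn_div_norm[abs_def])

text \<open>Polar coordinates without a surface measure: writing the radius as \<open>s = u * norm z\<close> turns the
  radial projection \<open>s *\<^sub>R sgn z\<close> into the dilation \<open>u *\<^sub>R z\<close>, so that only Fubini and the scaling
  of Lebesgue measure are needed.\<close>

lemma polar_lborel:
  fixes f :: "'a::euclidean_space \<Rightarrow> ennreal"
  assumes [measurable]: "f \<in> borel_measurable borel"
  shows "(\<integral>\<^sup>+s. ennreal (DIM('a) * s ^ (DIM('a) - 1)) * indicator {0<..<1} s *
            (\<integral>\<^sup>+z. f (s *\<^sub>R sgn z) * indicator (ball 0 1) z \<partial>lborel) \<partial>lborel)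
        = (\<integral>\<^sup>+z. f z * indicator (ball 0 1) z \<partial>lborel)"
proof -
  define d where "d = DIM('a)"
  have d: "d > 0" by (simp add: d_def)
  \<comment> \<open>The same integrand in three coordinate systems: \<open>k\<close> in
    \<open>(s, z)\<close>, \<open>k2\<close> after \<open>s = norm z * u\<close> with Jacobian
    \<open>norm z\<close>, and \<open>k3\<close> after \<open>y = u *\<^sub>R z\<close>, whose
    Jacobian \<open>u ^ d\<close> accounts for the power of \<open>u\<close> in its
    denominator.\<close>
  define k where "k = (\<lambda>(s::real) (z::'a). ennreal (d * s ^ (d - 1)) * indicator {0<..<1} s *
    (f (s *\<^sub>R sgn z) * indicator (ball 0 1) z))"
  define k2 where "k2 = (\<lambda>(u::real) (z::'a). ennreal (d * norm z ^ d * u ^ (d - 1)) *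
    indicator {0<..} u * indicator (ball 0 1) (u *\<^sub>R z) * indicator (ball 0 1) z * f (u *\<^sub>R z))"
  define k3 where "k3 = (\<lambda>(u::real) (y::'a). ennreal (d * norm y ^ d / u ^ Suc d) *
    indicator {0<..} u * indicator (ball 0 1) y * indicator (ball 0 u) y * f y)"
  have k_meas [measurable]: "case_prod k \<in> borel_measurable (lborel \<Otimes>\<^sub>M lborel)"
    unfolding k_def by measurable
  have k2_meas [measurable]: "case_prod k2 \<in> borel_measurable (lborel \<Otimes>\<^sub>M lborel)"
    unfolding k2_def by measurable
  have "case_prod k3 \<in> borel_measurable (borel \<Otimes>\<^sub>M borel)"
    unfolding k3_def mem_ball indicator_def by measurable
  then have k3_meas [measurable]: "case_prod k3 \<in> borel_measurable (lborel \<Otimes>\<^sub>M lborel)" by simp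
  have "(\<integral>\<^sup>+s. ennreal (d * s ^ (d - 1)) * indicator {0<..<1} s *
            (\<integral>\<^sup>+z. f (s *\<^sub>R sgn z) * indicator (ball 0 1) z \<partial>lborel) \<partial>lborel)
     = (\<integral>\<^sup>+s. \<integral>\<^sup>+z. k s z \<partial>lborel \<partial>lborel)"
    unfolding k_def by (intro nn_integral_cong nn_integral_cmult[symmetric]) measurable
  also have "\<dots> = (\<integral>\<^sup>+z. \<integral>\<^sup>+s. k s z \<partial>lborel \<partial>lborel)"
    by (rule lborel_pair.Fubini'[OF k_meas, symmetric])
  also have "\<dots> = (\<integral>\<^sup>+z. \<integral>\<^sup>+u. k2 u z \<partial>lborel \<partial>lborel)"
  proof (rule nn_integral_cong_AE, rule AE_mp[OF AE_lborel_singleton[of 0]], intro AE_I2 impI)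
    fix z :: 'a assume z: "z \<noteq> 0"
    have "(\<integral>\<^sup>+s. k s z \<partial>lborel) = norm z * (\<integral>\<^sup>+u. k (0 + norm z * u) z \<partial>lborel)"
      using z by (subst nn_integral_real_affine[where c="norm z" and t=0]) auto
    also have "\<dots> = (\<integral>\<^sup>+u. norm z * k (0 + norm z * u) z \<partial>lborel)"
      by (rule nn_integral_cmult[symmetric]) measurable
    also have "\<dots> = (\<integral>\<^sup>+u. k2 u z \<partial>lborel)"
    proof (rule nn_integral_cong)
      fix u :: real
      show "norm z * k (0 + norm z * u) z = k2 u z"
      proof (cases "0 < u")
        case True
        have "norm z ^ d = norm z * norm z ^ (d - 1)" using d by (simp add: power_eq_if)
        moreover have "ennreal (norm z) * ennreal (d * (norm z * u) ^ (d - 1))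
            = ennreal (norm z * (d * (norm z * u) ^ (d - 1)))"
          using True by (intro ennreal_mult[symmetric]) auto
        ultimately have "ennreal (norm z) * ennreal (d * (norm z * u) ^ (d - 1))
            = ennreal (d * norm z ^ d * u ^ (d - 1))"
          by (simp add: power_mult_distrib mult_ac)
        moreover have "(norm z * u) *\<^sub>R sgn z = u *\<^sub>R z"
          using z by (simp add: sgn_div_norm)
        moreover have "indicator {0<..<1} (norm z * u) = (indicator (ball 0 1) (u *\<^sub>R z) :: ennreal)"
          using True z by (auto simp: indicator_def mult.commute)
        ultimately have "norm z * k (0 + norm z * u) z = ennreal (d * norm z ^ d * u ^ (d - 1)) *
            (indicator (ball 0 1) (u *\<^sub>R z) * (f (u *\<^sub>R z) * indicator (ball 0 1) z))"
          by (simp add: k_def mult.assoc[symmetric])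
        then show ?thesis using True by (simp add: k2_def mult_ac)
      next
        case False
        then have "\<not> 0 < norm z * u" using z by (simp add: zero_less_mult_iff)
        with False show ?thesis by (simp add: k_def k2_def)
      qed
    qed
    finally show "(\<integral>\<^sup>+s. k s z \<partial>lborel) = (\<integral>\<^sup>+u. k2 u z \<partial>lborel)" .
  qed
  also have "\<dots> = (\<integral>\<^sup>+u. \<integral>\<^sup>+z. k2 u z \<partial>lborel \<partial>lborel)"
    by (rule lborel_pair.Fubini'[OF k2_meas])
  also have "\<dots> = (\<integral>\<^sup>+u. \<integral>\<^sup>+y. k3 u y \<partial>lborel \<partial>lborel)"
  proof (rule nn_integral_cong)
    fix u :: real
    show "(\<integral>\<^sup>+z. k2 u z \<partial>lborel) = (\<integral>\<^sup>+y. k3 u y \<partial>lborel)"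
    proof (cases "0 < u")
      case True
      have "(\<integral>\<^sup>+y. k3 u y \<partial>lborel) = ennreal (\<bar>u\<bar> ^ DIM('a)) * (\<integral>\<^sup>+z. k3 u (0 + u *\<^sub>R z) \<partial>lborel)"
        using True by (intro nn_integral_lborel_scale) auto
      also have "\<dots> = (\<integral>\<^sup>+z. ennreal (\<bar>u\<bar> ^ DIM('a)) * k3 u (0 + u *\<^sub>R z) \<partial>lborel)"
        by (rule nn_integral_cmult[symmetric]) measurable
      also have "\<dots> = (\<integral>\<^sup>+z. k2 u z \<partial>lborel)"
      proof (rule nn_integral_cong)
        fix z :: 'a
        have "ennreal (u ^ d) * ennreal (d * norm (u *\<^sub>R z) ^ d / u ^ Suc d)
          = ennreal (u ^ d * (d * norm (u *\<^sub>R z) ^ d / u ^ Suc d))"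
          using True by (intro ennreal_mult[symmetric]) auto
        also have "u ^ d * (d * norm (u *\<^sub>R z) ^ d / u ^ Suc d) = d * norm z ^ d * u ^ (d - 1)"
          using True d by (cases d) (auto simp: power_mult_distrib field_simps)
        finally have "ennreal (\<bar>u\<bar> ^ DIM('a)) * k3 u (0 + u *\<^sub>R z) =
            ennreal (d * norm z ^ d * u ^ (d - 1)) *
            (indicator (ball 0 1) (u *\<^sub>R z) * indicator (ball 0 u) (u *\<^sub>R z) * f (u *\<^sub>R z))"
          using True by (simp add: k3_def d_def[symmetric] mult.assoc[symmetric] del: power_Suc)
        moreover have "indicator (ball 0 u) (u *\<^sub>R z) = (indicator (ball 0 1) z :: ennreal)"
          using True by (auto simp: indicator_def)
        ultimately show "ennreal (\<bar>u\<bar> ^ DIM('a)) * k3 u (0 + u *\<^sub>R z) = k2 u z"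
          using True by (simp add: k2_def mult_ac)
      qed
      finally show ?thesis ..
    qed (simp add: k2_def k3_def)
  qed
  also have "\<dots> = (\<integral>\<^sup>+y. \<integral>\<^sup>+u. k3 u y \<partial>lborel \<partial>lborel)"
    by (rule lborel_pair.Fubini'[OF k3_meas, symmetric])
  also have "\<dots> = (\<integral>\<^sup>+y. f y * indicator (ball 0 1) y \<partial>lborel)"
  proof (rule nn_integral_cong_AE, rule AE_mp[OF AE_lborel_singleton[of 0]], intro AE_I2 impI)
    fix y :: 'a assume y: "y \<noteq> 0"
    \<comment> \<open>For fixed \<open>y\<close> the constraint \<open>y \<in> ball 0 u\<close> is
      the tail \<open>u > norm y\<close>. Its integral \<open>1 / norm y ^ d\<close> cancels the
      factor \<open>norm y ^ d\<close>.\<close>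
    have "(\<integral>\<^sup>+u. k3 u y \<partial>lborel) = (\<integral>\<^sup>+u. (ennreal (norm y ^ d) * f y * indicator (ball 0 1) y) *
        (ennreal (real d / u ^ Suc d) * indicator {norm y<..} u) \<partial>lborel)"
    proof (rule nn_integral_cong)
      fix u :: real
      show "k3 u y = (ennreal (norm y ^ d) * f y * indicator (ball 0 1) y) *
        (ennreal (real d / u ^ Suc d) * indicator {norm y<..} u)"
      proof (cases "norm y < u")
        case True
        then have u: "u > 0" using norm_ge_zero[of y] by linarith
        have "ennreal (d * norm y ^ d / u ^ Suc d) = ennreal (norm y ^ d) * ennreal (real d / u ^ Suc d)"
          using u by (subst ennreal_mult[symmetric]) auto
        then have "k3 u y = (ennreal (norm y ^ d) * ennreal (real d / u ^ Suc d)) * (indicator (ball 0 1) y * f y)"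
          using True u by (simp add: k3_def mult.assoc del: power_Suc)
        also have "\<dots> = (ennreal (norm y ^ d) * f y * indicator (ball 0 1) y) * ennreal (real d / u ^ Suc d)"
          by (simp only: mult_ac)
        finally show ?thesis using True by (simp del: power_Suc)
      qed (simp add: k3_def)
    qed
    also have "\<dots> = (ennreal (norm y ^ d) * f y * indicator (ball 0 1) y) * ennreal (1 / norm y ^ d)"
      using y d by (subst nn_integral_cmult) (auto simp: nn_integral_inverse_power_tail simp del: power_Suc)
    also have "\<dots> = (ennreal (norm y ^ d) * ennreal (1 / norm y ^ d)) * (f y * indicator (ball 0 1) y)"
      by (simp only: mult_ac)
    also have "ennreal (norm y ^ d) * ennreal (1 / norm y ^ d) = 1"
      using y by (simp flip: ennreal_mult)
    finally show "(\<integral>\<^sup>+u. k3 u y \<partial>lborel) = f y * indicator (ball 0 1) y" by simp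
  qed
  finally show ?thesis unfolding d_def .
qed

lemma bavg_polar:
  fixes f :: "'a::euclidean_space \<Rightarrow> ennreal"
  assumes [measurable]: "f \<in> borel_measurable borel"
  shows "bavg r f x = (\<integral>\<^sup>+s. ennreal (DIM('a) * s ^ (DIM('a) - 1)) * indicator {0<..<1} s *
     smean (r * s) f x \<partial>lborel)"
proof -
  let ?c = "\<lambda>s::real. ennreal (DIM('a) * s ^ (DIM('a) - 1)) * indicator {0<..<1} s"
  let ?e = "emeasure lborel (ball (0::'a) 1)"
  have "(\<integral>\<^sup>+s. ?c s * smean (r * s) f x \<partial>lborel) =
     (\<integral>\<^sup>+s. (?c s * (\<integral>\<^sup>+z. f (x + r *\<^sub>R (s *\<^sub>R sgn z)) * indicator (ball 0 1) z \<partial>lborel)) / ?e \<partial>lborel)"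
    unfolding smean_def
    by (intro nn_integral_cong, subst nn_integral_unit_ball_measure)
       (auto simp: ennreal_times_divide)
  also have "\<dots> = (\<integral>\<^sup>+s. ?c s * (\<integral>\<^sup>+z. f (x + r *\<^sub>R (s *\<^sub>R sgn z)) * indicator (ball 0 1) z \<partial>lborel) \<partial>lborel) / ?e"
    by (rule nn_integral_divide) measurable
  also have "\<dots> = bavg r f x"
    unfolding bavg_def
    by (subst polar_lborel[of "\<lambda>z. f (x + r *\<^sub>R z)"]) (auto simp: nn_integral_unit_ball_measure)
  finally show ?thesis ..
qed

lemma le_bavg_if_le_smean:
  fixes f :: "'a::euclidean_space \<Rightarrow> ennreal"
  assumes [measurable]: "f \<in> borel_measurable borel"
    and le: "\<And>s. 0 < s \<Longrightarrow> s < r \<Longrightarrow> a \<le> smean s f x" and "r > 0"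
  shows "a \<le> bavg r f x"
proof -
  let ?c = "\<lambda>s::real. ennreal (DIM('a) * s ^ (DIM('a) - 1)) * indicator {0<..<1} s"
  \<comment> \<open>The total mass of the radial weight is read off from \<open>bavg_polar\<close>
    for the constant function 1, so that it needs no separate computation.\<close>
  have "bavg 1 (\<lambda>_. 1) (0::'a) = (\<integral>\<^sup>+s. ?c s \<partial>lborel)"
    by (subst bavg_polar) (auto simp: smean_def)
  then have 1: "(\<integral>\<^sup>+s. ?c s \<partial>lborel) = 1" by (simp add: bavg_def)
  have "a = (\<integral>\<^sup>+s. ?c s * a \<partial>lborel)"
    using 1 by (subst nn_integral_multc) auto
  also have "\<dots> \<le> (\<integral>\<^sup>+s. ?c s * smean (r * s) f x \<partial>lborel)"
    using \<open>r > 0\<close> by (intro nn_integral_mono) (auto simp: indicator_def intro!: mult_left_mono le)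
  also have "\<dots> = bavg r f x" by (simp add: bavg_polar)
  finally show ?thesis .
qed

interpretation ubm: prob_space "unit_ball_measure :: 'a::euclidean_space measure"
  by (rule prob_space_unit_ball_measure)

lemma measurable_bavg [measurable]:
  assumes [measurable]: "f \<in> borel_measurable borel"
  shows "bavg r f \<in> borel_measurable borel"
  unfolding bavg_def[abs_def] by measurable

lemma measurable_smean [measurable]:
  assumes [measurable]: "f \<in> borel_measurable borel"
  shows "smean r f \<in> borel_measurable borel"
  unfolding smean_def[abs_def] by measurable

lemma bavg_mono:
  assumes "\<And>y. y \<in> ball x r \<Longrightarrow> f y \<le> g y" "r > 0"
  shows "bavg r f x \<le> bavg r g x"
  unfolding bavg_def
proof (rule nn_integral_mono_AE, rule AE_mp[OF AE_unit_ball_measure], intro AE_I2 impI)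
  fix z :: 'a assume "z \<in> ball 0 1"
  then have "x + r *\<^sub>R z \<in> ball x r" using \<open>r > 0\<close> by (simp add: dist_norm)
  then show "f (x + r *\<^sub>R z) \<le> g (x + r *\<^sub>R z)" by (rule assms)
qed

lemma bavg_const [simp]: "bavg r (\<lambda>_. c) x = c"
  by (simp add: bavg_def)

section \<open>Volume estimates for ball means\<close>

lemma content_ball_eq: "measure lborel (ball (x::'a::euclidean_space) r) = measure lborel (ball (0::'a) r)"
  by (cases "r \<ge> 0")
     (simp_all only: content_ball_conv_unit_ball[of r x] content_ball_conv_unit_ball[of r "0::'a"] ball_empty not_le less_imp_le)

lemma emeasure_ball_eq:
  "emeasure lborel (ball (x::'a::euclidean_space) r) = ennreal (measure lborel (ball (0::'a) r))"
  using emeasure_lborel_ball_finite[of x r] content_ball_eq[of x r]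
  by (simp add: emeasure_eq_ennreal_measure)

lemma set_nn_integral_ball:
  fixes f :: "'a::euclidean_space \<Rightarrow> ennreal"
  assumes [measurable]: "f \<in> borel_measurable borel" and r: "r > 0"
  shows "(\<integral>\<^sup>+y. f y * indicator (ball x r) y \<partial>lborel) = ennreal (measure lborel (ball (0::'a) r)) * bavg r f x"
proof -
  let ?e = "emeasure lborel (ball (0::'a) 1)"
  have *: "indicator (ball x r) (x + r *\<^sub>R z) = (indicator (ball 0 1) z :: ennreal)" for z
    using r by (auto simp: indicator_def dist_norm)
  have e: "?e = ennreal (measure lborel (ball (0::'a) 1))" by (rule emeasure_ball_eq)
  have "(\<integral>\<^sup>+y. f y * indicator (ball x r) y \<partial>lborel)
      = ennreal (r ^ DIM('a)) * (\<integral>\<^sup>+z. f (x + r *\<^sub>R z) * indicator (ball 0 1) z \<partial>lborel)"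
    using r by (subst nn_integral_lborel_scale[where c=r and t=x]) (auto simp: *)
  also have "(\<integral>\<^sup>+z. f (x + r *\<^sub>R z) * indicator (ball 0 1) z \<partial>lborel) = ?e * bavg r f x"
  proof -
    let ?I = "\<integral>\<^sup>+z. f (x + r *\<^sub>R z) * indicator (ball 0 1) z \<partial>lborel"
    have "bavg r f x = ?I / ?e"
      unfolding bavg_def by (rule nn_integral_unit_ball_measure) measurable
    moreover have "?e * (?I / ?e) = ?I * ?e / ?e"
      by (simp only: ennreal_times_divide mult.commute)
    moreover have "?I * ?e / ?e = ?I"
      by (rule mult_divide_eq_ennreal[OF unit_ball_emeasure_pos]) (simp add: e)
    ultimately show ?thesis by simp
  qed
  also have "ennreal (r ^ DIM('a)) * (?e * bavg r f x) = ennreal (measure lborel (ball (0::'a) r)) * bavg r f x"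
    using r by (simp add: e content_ball_conv_unit_ball[of r "0::'a"] ennreal_mult mult.assoc)
  finally show ?thesis .
qed

lemma bavg_le_of_nn_integral_le:
  fixes f :: "'a::euclidean_space \<Rightarrow> ennreal"
  assumes [measurable]: "f \<in> borel_measurable borel" and r: "r > 0" and C: "C \<ge> 0"
    and le: "(\<integral>\<^sup>+y. f y \<partial>lborel) \<le> ennreal C"
  shows "bavg r f x \<le> ennreal (C / measure lborel (ball (0::'a) r))"
proof -
  let ?c = "measure lborel (ball (0::'a) r)"
  have c: "?c > 0" using r by (rule content_ball_pos)
  have "ennreal ?c * bavg r f x = (\<integral>\<^sup>+y. f y * indicator (ball x r) y \<partial>lborel)"
    using r by (simp add: set_nn_integral_ball)
  also have "\<dots> \<le> (\<integral>\<^sup>+y. f y \<partial>lborel)"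
    by (rule nn_integral_mono) (auto simp: indicator_def)
  also note le
  also have "ennreal C = ennreal ?c * ennreal (C / ?c)"
    using c C by (simp flip: ennreal_mult)
  finally show ?thesis
    using c by (simp add: ennreal_mult_le_mult_iff)
qed

text \<open>Compactness gives a uniform margin around the closed ball, and a point slightly outside
  that ball lies within the margin of its radial projection. The slack \<open>t\<close> is what
  later keeps balls around nearby centres inside \<open>Y\<close>.\<close>

lemma cball_subset_open_enlarge:
  fixes x :: "'a::euclidean_space"
  assumes "open Y" "cball x r \<subseteq> Y" "r \<ge> 0"
  obtains t where "t > 0" "ball x (r + t) \<subseteq> Y"
proof -
  obtain e where e: "e > 0" "(\<Union>y\<in>cball x r. cball y e) \<subseteq> Y"
    using compact_subset_open_imp_cball_epsilon_subset[OF compact_cball assms(1,2)] .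
  have "ball x (r + e) \<subseteq> Y"
  proof
    fix w assume "w \<in> ball x (r + e)"
    then have w: "norm (w - x) < r + e" by (simp add: dist_norm norm_minus_commute)
    show "w \<in> Y"
    proof (cases "norm (w - x) \<le> r")
      case True
      then show ?thesis using assms(2) by (auto simp: dist_norm norm_minus_commute)
    next
      case False
      define y where "y = x + (r / norm (w - x)) *\<^sub>R (w - x)"
      have n: "norm (w - x) > r" using False by simp
      then have "norm (w - x) > 0" using assms(3) by linarith
      have "y \<in> cball x r"
        using assms(3) by (auto simp: y_def dist_norm)
      moreover have "w - y = (1 - r / norm (w - x)) *\<^sub>R (w - x)"
        by (simp add: y_def algebra_simps)
      then have "norm (w - y) = (1 - r / norm (w - x)) * norm (w - x)"
        using n assms(3) by (simp add: divide_le_eq)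
      then have "norm (w - y) = norm (w - x) - r"
        using \<open>norm (w - x) > 0\<close> by (simp add: algebra_simps)
      then have "w \<in> cball y e" using w by (simp add: dist_norm norm_minus_commute)
      ultimately show ?thesis using e(2) by blast
    qed
  qed
  with e(1) that show thesis by blast
qed

text \<open>Moving the centre from \<open>b\<close> to \<open>a\<close> adds at most the integral
  over \<open>ball a r - ball b r\<close>. This set lies in the shell
  \<open>ball b (r + s) - ball b r\<close>, whose volume depends on \<open>r\<close> and
  \<open>s\<close> only, and the integrand there is at most \<open>M\<close>.\<close>

lemma bavg_le_bavg_plus:
  fixes f :: "'a::euclidean_space \<Rightarrow> ennreal"
  assumes [measurable]: "f \<in> borel_measurable borel" and r: "r > 0" and s: "s \<ge> 0" and M: "M \<ge> 0" and e: "e \<ge> 0"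
    and ab: "dist a b \<le> s" and bd: "\<And>y. y \<in> ball a r \<Longrightarrow> f y \<le> ennreal M"
    and le: "M * (measure lborel (ball (0::'a) (r + s)) - measure lborel (ball (0::'a) r)) \<le> measure lborel (ball (0::'a) r) * e"
  shows "bavg r f a \<le> bavg r f b + ennreal e"
proof -
  let ?c = "measure lborel (ball (0::'a) r)"
  have c: "?c > 0" using r by (rule content_ball_pos)
  have sub: "ball a r - ball b r \<subseteq> ball b (r + s) - ball b r"
  proof
    fix y assume y: "y \<in> ball a r - ball b r"
    have "dist b y \<le> dist a b + dist a y" by (metis dist_commute dist_triangle)
    with y ab show "y \<in> ball b (r + s) - ball b r" by auto
  qed
  have "ennreal ?c * bavg r f a = (\<integral>\<^sup>+y. f y * indicator (ball a r) y \<partial>lborel)"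
    using r by (simp add: set_nn_integral_ball)
  also have "\<dots> \<le> (\<integral>\<^sup>+y. f y * indicator (ball b r) y + ennreal M * indicator (ball a r - ball b r) y \<partial>lborel)"
    by (rule nn_integral_mono) (use bd in \<open>auto simp: indicator_def\<close>)
  also have "\<dots> = ennreal ?c * bavg r f b + ennreal M * emeasure lborel (ball a r - ball b r)"
    using r by (subst nn_integral_add) (auto simp: set_nn_integral_ball nn_integral_cmult)
  also have "emeasure lborel (ball a r - ball b r) \<le> emeasure lborel (ball b (r + s) - ball b r)"
    by (rule emeasure_mono[OF sub]) auto
  also have "\<dots> = ennreal (measure lborel (ball (0::'a) (r + s)) - ?c)"
    using s r by (subst emeasure_Diff) (auto simp: emeasure_ball_eq subset_ball ennreal_minus)
  also have "ennreal M * \<dots> \<le> ennreal ?c * ennreal e"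
    using le M c e by (simp add: ennreal_leI flip: ennreal_mult')
  finally have "ennreal ?c * bavg r f a \<le> ennreal ?c * (bavg r f b + ennreal e)"
    by (simp add: distrib_left add_left_mono mult_left_mono)
  then show ?thesis using c by (simp add: ennreal_mult_le_mult_iff)
qed

text \<open>Ball volume is a constant times \<open>r ^ DIM('a)\<close>, hence continuous in the
  radius, and the right-hand side is strictly positive.\<close>

lemma content_ball_increment_small:
  assumes "r > 0" "M \<ge> 0" "e > 0" "t > 0"
  shows "\<exists>s>0. s \<le> t \<and> M * (measure lborel (ball (0::'a::euclidean_space) (r + s)) - measure lborel (ball (0::'a) r))
    \<le> measure lborel (ball (0::'a) r) * e"
proof -
  let ?c = "\<lambda>r. r ^ DIM('a) * measure lborel (ball (0::'a) 1)"
  have "((\<lambda>s. M * (?c (r + s) - ?c r)) \<longlongrightarrow> M * (?c (r + 0) - ?c r)) (at_right 0)"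
    by (intro tendsto_intros)
  moreover have "0 < ?c r * e"
    using assms content_ball_pos[of 1 "0::'a"] by simp
  ultimately have "eventually (\<lambda>s. M * (?c (r + s) - ?c r) < ?c r * e) (at_right 0)"
    by (intro order_tendstoD(2)) auto
  moreover have "eventually (\<lambda>s. s \<in> {0<..<t}) (at_right 0)"
    using assms by (intro eventually_at_right_real)
  ultimately have "eventually (\<lambda>s. s > 0 \<and> s \<le> t \<and> M * (?c (r + s) - ?c r) < ?c r * e) (at_right 0)"
    by eventually_elim auto
  then obtain s where "s > 0" "s \<le> t" "M * (?c (r + s) - ?c r) < ?c r * e"
    using eventually_happens'[OF trivial_limit_at_right_real] by blast
  then show ?thesis using assms
    using content_ball_conv_unit_ball[of r "0::'a"] content_ball_conv_unit_ball[of "r + s" "0::'a"]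
    by (intro exI[of _ s]) auto
qed

text \<open>Both operators average translates of \<open>f\<close>, so this is Fubini. It carries the
  sphere inequality from a function to its ball means.\<close>

lemma bavg_smean_commute:
  fixes f :: "'a::euclidean_space \<Rightarrow> ennreal"
  assumes [measurable]: "f \<in> borel_measurable borel"
  shows "bavg r (smean s f) x = smean s (bavg r f) x"
proof -
  interpret P: pair_sigma_finite "unit_ball_measure :: 'a measure" "unit_ball_measure :: 'a measure" ..
  have m: "(\<lambda>(w, z). f (x + r *\<^sub>R z + s *\<^sub>R sgn w)) \<in> borel_measurable (unit_ball_measure \<Otimes>\<^sub>M unit_ball_measure)"
    by measurable
  have "bavg r (smean s f) x = (\<integral>\<^sup>+z. \<integral>\<^sup>+w. f (x + r *\<^sub>R z + s *\<^sub>R sgn w) \<partial>unit_ball_measure \<partial>unit_ball_measure)"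
    by (simp add: bavg_def smean_def)
  also have "\<dots> = (\<integral>\<^sup>+w. \<integral>\<^sup>+z. f (x + r *\<^sub>R z + s *\<^sub>R sgn w) \<partial>unit_ball_measure \<partial>unit_ball_measure)"
    by (rule P.Fubini'[OF m])
  also have "\<dots> = smean s (bavg r f) x"
    unfolding bavg_def smean_def by (intro nn_integral_cong arg_cong[where f=f]) simp
  finally show ?thesis .
qed

section \<open>Compactness for the sub-mean-value property\<close>

lemma limsup_le_limsup_plus:
  fixes a b :: "nat \<Rightarrow> ennreal"
  assumes "\<And>n. a n \<le> b n + c"
  shows "limsup a \<le> limsup b + c"
proof -
  have "limsup a \<le> limsup (\<lambda>n. c + b n)"
    by (intro Limsup_mono always_eventually allI) (metis assms add.commute)
  also have "\<dots> = c + limsup b" by (rule Limsup_const_add) simp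
  finally show ?thesis by (simp add: add.commute)
qed

lemma liminf_le_liminf_plus:
  fixes a b :: "nat \<Rightarrow> ennreal"
  assumes "\<And>n. a n \<le> b n + c"
  shows "liminf a \<le> liminf b + c"
proof -
  have "liminf a \<le> liminf (\<lambda>n. b n + c)"
    by (intro Liminf_mono always_eventually allI assms)
  also have "\<dots> = liminf b + c" by (rule Liminf_add_const) simp
  finally show ?thesis .
qed

text \<open>Using a fixed null sequence of radii keeps the family of ball means countable, as the
  diagonal extraction requires.\<close>

definition rad :: "nat \<Rightarrow> real" where
  "rad m = inverse (real (Suc m))"

lemma rad_pos: "rad m > 0"
  by (simp add: rad_def)

lemma rad_tendsto: "rad \<longlonglongrightarrow> 0"
  unfolding rad_def[abs_def] by (rule LIMSEQ_inverse_real_of_nat)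

lemma eventually_rad_less: "e > 0 \<Longrightarrow> \<forall>\<^sub>F m in sequentially. rad m < e"
  using order_tendstoD(2)[OF rad_tendsto] .

text \<open>The functions are extended by 0 outside \<open>Y\<close>, so that ball means make sense
  at every centre and are controlled by the Lebesgue mass bound \<open>C\<close>. The sub-mean-value
  property is still required only for closed balls inside \<open>Y\<close>.\<close>

locale submean_sequence =
  fixes Y :: "'a::euclidean_space set" and p :: "nat \<Rightarrow> 'a \<Rightarrow> ennreal" and C :: real
  assumes open_Y: "open Y"
    and meas [measurable]: "\<And>n. p n \<in> borel_measurable borel"
    and outside: "\<And>n y. y \<notin> Y \<Longrightarrow> p n y = 0"
    and submean: "\<And>n x r. r > 0 \<Longrightarrow> cball x r \<subseteq> Y \<Longrightarrow> p n x \<le> smean r (p n) x"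
    and C_nonneg: "C \<ge> 0"
    and mass: "\<And>n. (\<integral>\<^sup>+y. p n y \<partial>lborel) \<le> ennreal C"
begin

text \<open>Mass divided by volume: it bounds every mean over a ball of radius \<open>r\<close>,
  uniformly in the index, and hence the functions themselves wherever the ball of radius
  \<open>r\<close> stays in \<open>Y\<close>.\<close>

definition bnd :: "real \<Rightarrow> real" where
  "bnd r = C / measure lborel (ball (0::'a) r)"

lemma bnd_nonneg: "bnd r \<ge> 0"
  using C_nonneg by (simp add: bnd_def)

lemma le_bavg:
  assumes "r > 0" "ball x r \<subseteq> Y"
  shows "p n x \<le> bavg r (p n) x"
proof (rule le_bavg_if_le_smean)
  fix s assume "0 < s" "s < r"
  then have "cball x s \<subseteq> Y" using assms(2) by (auto simp: subset_iff)
  with \<open>0 < s\<close> show "p n x \<le> smean s (p n) x" by (rule submean)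
qed (use assms in auto)

lemma bavg_le_bnd: "r > 0 \<Longrightarrow> bavg r (p n) x \<le> ennreal (bnd r)"
  unfolding bnd_def by (rule bavg_le_of_nn_integral_le) (auto simp: mass C_nonneg)

lemma le_bnd: "r > 0 \<Longrightarrow> ball x r \<subseteq> Y \<Longrightarrow> p n x \<le> ennreal (bnd r)"
  using le_bavg bavg_le_bnd order_trans by blast

text \<open>Near \<open>cball x r\<close> all \<open>p n\<close> share one upper bound, so the shell
  estimate gives an \<open>s\<close> that does not depend on \<open>n\<close>. Two one-sided
  inequalities replace an absolute difference, which is awkward in \<open>ennreal\<close>.\<close>

lemma bavg_equicontinuous:
  assumes r: "r > 0" and x: "cball x r \<subseteq> Y" and e: "e > 0"
  obtains s where "s > 0" "\<And>q n. dist x q < s \<Longrightarrow> bavg r (p n) q \<le> bavg r (p n) x + ennreal e"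
    "\<And>q n. dist x q < s \<Longrightarrow> bavg r (p n) x \<le> bavg r (p n) q + ennreal e"
proof -
  obtain t where t: "t > 0" "ball x (r + t) \<subseteq> Y"
    using cball_subset_open_enlarge[OF open_Y x] r by auto
  \<comment> \<open>A point at distance less than \<open>r + t / 2\<close> from \<open>x\<close> has
    its ball of radius \<open>t / 2\<close> inside \<open>ball x (r + t) \<subseteq> Y\<close>, so
    \<open>bnd (t / 2)\<close> bounds every \<open>p n\<close> there.\<close>
  define M where "M = bnd (t / 2)"
  have "M \<ge> 0" by (simp add: M_def bnd_nonneg)
  obtain s where s: "s > 0" "s \<le> t / 2"
    "M * (measure lborel (ball (0::'a) (r + s)) - measure lborel (ball (0::'a) r)) \<le> measure lborel (ball (0::'a) r) * e"
    using content_ball_increment_small[of r M e "t / 2"] r \<open>M \<ge> 0\<close> e t(1) by auto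
  have bd: "p n y \<le> ennreal M" if "dist x y < r + t / 2" for n y
    unfolding M_def
  proof (rule le_bnd)
    show "ball y (t / 2) \<subseteq> Y"
    proof
      fix w assume "w \<in> ball y (t / 2)"
      with that dist_triangle[of x w y] have "w \<in> ball x (r + t)" by simp
      with t(2) show "w \<in> Y" by blast
    qed
  qed (use t in simp)
  show thesis
  proof (rule that[OF s(1)])
    fix q n assume q: "dist x q < s"
    have "p n y \<le> ennreal M" if "y \<in> ball q r" for y
      using bd[of y n] that q s(2) dist_triangle[of x y q] by simp
    then show "bavg r (p n) q \<le> bavg r (p n) x + ennreal e"
      using r s \<open>M \<ge> 0\<close> e q by (intro bavg_le_bavg_plus[where s=s and M=M]) (auto simp: dist_commute)
    have "p n y \<le> ennreal M" if "y \<in> ball x r" for y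
      using bd[of y n] that t(1) by simp
    then show "bavg r (p n) x \<le> bavg r (p n) q + ennreal e"
      using r s \<open>M \<ge> 0\<close> e q by (intro bavg_le_bavg_plus[where s=s and M=M]) auto
  qed
qed

lemma subsequence: "submean_sequence Y (\<lambda>n. p (k n)) C"
  by unfold_locales (auto simp: open_Y outside submean C_nonneg mass)

lemma convergent_subsequence:
  assumes "countable D"
  obtains k where "strict_mono (k :: nat \<Rightarrow> nat)"
    "\<And>q m. q \<in> D \<Longrightarrow> convergent (\<lambda>n. bavg (rad m) (p (k n)) q)"
proof -
  \<comment> \<open>Dividing by \<open>1 + bnd\<close> gives all means the common bound 1 demanded
    by the diagonal extraction, whatever the radius; the summand 1 prevents division by zero when
    the mass bound is 0.\<close>
  define F where "F = (\<lambda>n (qm :: 'a \<times> nat). enn2real (bavg (rad (snd qm)) (p n) (fst qm)) / (1 + bnd (rad (snd qm))))"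
  have cD: "countable (D \<times> (UNIV :: nat set))" using assms by simp
  have F: "norm (F n qm) \<le> 1" for n qm
  proof -
    have "enn2real (bavg (rad (snd qm)) (p n) (fst qm)) \<le> bnd (rad (snd qm))"
      by (rule enn2real_leI) (auto simp: bnd_nonneg bavg_le_bnd rad_pos)
    then show ?thesis using bnd_nonneg[of "rad (snd qm)"] by (simp add: F_def divide_le_eq)
  qed
  obtain k where k: "strict_mono (k :: nat \<Rightarrow> nat)"
    "\<And>x. x \<in> D \<times> (UNIV :: nat set) \<Longrightarrow> \<exists>l. (\<lambda>n. F (k n) x) \<longlonglongrightarrow> l"
    by (rule function_convergent_subsequence[of "D \<times> UNIV" F 1, OF cD F]) blast
  show thesis
  proof (rule that[OF k(1)])
    fix q m assume "q \<in> D"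
    define b where "b = 1 + bnd (rad m)"
    have b: "b > 0" using bnd_nonneg[of "rad m"] by (simp add: b_def)
    obtain l where l: "(\<lambda>n. F (k n) (q, m)) \<longlonglongrightarrow> l" using k(2)[of "(q, m)"] \<open>q \<in> D\<close> by auto
    have "(\<lambda>n. ennreal (b * F (k n) (q, m))) \<longlonglongrightarrow> ennreal (b * l)"
      by (intro tendsto_ennrealI tendsto_intros l)
    moreover have "ennreal (b * F (k n) (q, m)) = bavg (rad m) (p (k n)) q" for n
    proof -
      have "bavg (rad m) (p (k n)) q < top"
        using bavg_le_bnd[OF rad_pos, of m "k n" q] le_less_trans ennreal_less_top by blast
      then show ?thesis using b by (simp add: F_def b_def[symmetric])
    qed
    ultimately show "convergent (\<lambda>n. bavg (rad m) (p (k n)) q)"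
      by (auto simp: convergent_def)
  qed
qed

end

section \<open>Limits of ball means along a convergent subsequence\<close>

locale submean_sequence_conv = submean_sequence Y p C
  for Y :: "'a::euclidean_space set" and p C +
  fixes D :: "'a set"
  assumes dense_D: "\<And>S. open S \<Longrightarrow> S \<noteq> {} \<Longrightarrow> \<exists>d\<in>D. d \<in> S"
    and conv: "\<And>q m. q \<in> D \<Longrightarrow> convergent (\<lambda>n. bavg (rad m) (p n) q)"
begin

text \<open>A limsup makes \<open>L m\<close> measurable on the whole space. At points with
  \<open>cball x (rad m) \<subseteq> Y\<close> it is a true limit, by
  \<open>L_le_liminf\<close>.\<close>

definition L :: "nat \<Rightarrow> 'a \<Rightarrow> ennreal" where
  "L m x = limsup (\<lambda>n. bavg (rad m) (p n) x)"

definition U :: "'a \<Rightarrow> ennreal" where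
  "U x = limsup (\<lambda>m. L m x)"

lemma measurable_L [measurable]: "L m \<in> borel_measurable borel"
  unfolding L_def[abs_def] by measurable

lemma measurable_U [measurable]: "U \<in> borel_measurable borel"
  unfolding U_def[abs_def] by measurable

text \<open>Equicontinuity spreads convergence from the dense set: passing from \<open>x\<close> to
  a nearby \<open>q \<in> D\<close> and back costs \<open>e / 2\<close> each time, and at
  \<open>q\<close> limsup and liminf agree.\<close>

lemma L_le_liminf:
  assumes x: "cball x (rad m) \<subseteq> Y"
  shows "L m x \<le> liminf (\<lambda>n. bavg (rad m) (p n) x)"
proof (rule ennreal_le_epsilon)
  fix e :: real assume e: "0 < e"
  obtain s where s: "s > 0"
    "\<And>q n. dist x q < s \<Longrightarrow> bavg (rad m) (p n) q \<le> bavg (rad m) (p n) x + ennreal (e / 2)"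
    "\<And>q n. dist x q < s \<Longrightarrow> bavg (rad m) (p n) x \<le> bavg (rad m) (p n) q + ennreal (e / 2)"
    using bavg_equicontinuous[OF rad_pos x, of "e / 2"] e by auto
  obtain q where q: "q \<in> D" "dist x q < s"
    using dense_D[of "ball x s"] s(1) by auto
  have "L m x \<le> limsup (\<lambda>n. bavg (rad m) (p n) q) + ennreal (e / 2)"
    unfolding L_def by (rule limsup_le_limsup_plus) (rule s(3)[OF q(2)])
  also have "limsup (\<lambda>n. bavg (rad m) (p n) q) = liminf (\<lambda>n. bavg (rad m) (p n) q)"
    using conv[OF q(1), of m] by (simp add: convergent_limsup_cl convergent_liminf_cl)
  also have "liminf (\<lambda>n. bavg (rad m) (p n) q) \<le> liminf (\<lambda>n. bavg (rad m) (p n) x) + ennreal (e / 2)"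
    by (rule liminf_le_liminf_plus) (rule s(2)[OF q(2)])
  also have "liminf (\<lambda>n. bavg (rad m) (p n) x) + ennreal (e / 2) + ennreal (e / 2) =
      liminf (\<lambda>n. bavg (rad m) (p n) x) + ennreal e"
    using e by (simp add: add.assoc flip: ennreal_plus)
  finally show "L m x \<le> liminf (\<lambda>n. bavg (rad m) (p n) x) + ennreal e"
    by (simp add: add_right_mono)
qed

lemma L_usc:
  assumes x: "cball x (rad m) \<subseteq> Y" and e: "e > 0"
  obtains s where "s > 0" "\<And>q. dist x q < s \<Longrightarrow> L m q \<le> L m x + ennreal e"
proof -
  obtain s where s: "s > 0"
    "\<And>q n. dist x q < s \<Longrightarrow> bavg (rad m) (p n) q \<le> bavg (rad m) (p n) x + ennreal e"
    by (rule bavg_equicontinuous[OF rad_pos x e]) blast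
  show thesis
    by (rule that[OF s(1)]) (auto simp: L_def intro!: limsup_le_limsup_plus s(2))
qed

lemma L_le_bnd: "L m x \<le> ennreal (bnd (rad m))"
  unfolding L_def by (rule Limsup_bounded) (auto simp: bavg_le_bnd rad_pos)

text \<open>Ball means of a submean function need no monotonicity in the radius here: the mean over a
  small ball is at most the mean of the larger-ball means, and these are upper semicontinuous.\<close>

lemma U_le_L:
  assumes x: "cball x (rad j) \<subseteq> Y"
  shows "U x \<le> L j x"
proof (rule ennreal_le_epsilon)
  fix e :: real assume e: "0 < e"
  obtain t where t: "t > 0" "ball x (rad j + t) \<subseteq> Y"
    using cball_subset_open_enlarge[OF open_Y x] rad_pos[of j] by auto
  obtain s where s: "s > 0" "\<And>q. dist x q < s \<Longrightarrow> L j q \<le> L j x + ennreal e"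
    using L_usc[OF x e] by auto
  have "\<forall>\<^sub>F m in sequentially. rad m < min s t"
    using s(1) t(1) by (intro eventually_rad_less) auto
  then have "\<forall>\<^sub>F m in sequentially. L m x \<le> L j x + ennreal e"
  proof eventually_elim
    case (elim m)
    \<comment> \<open>For centres \<open>y\<close> with \<open>dist x y < t\<close> the ball of
      radius \<open>rad j\<close> around \<open>y\<close> still lies in \<open>Y\<close>, so
      \<open>p n y\<close> may be replaced by its mean of radius \<open>rad j\<close>.\<close>
    have "L m x \<le> limsup (\<lambda>n. bavg (rad m) (bavg (rad j) (p n)) x)"
      unfolding L_def
    proof (intro Limsup_mono always_eventually allI bavg_mono rad_pos le_bavg)
      fix n y assume "y \<in> ball x (rad m)"
      then have y: "dist x y < t" using elim by simp
      show "ball y (rad j) \<subseteq> Y"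
      proof
        fix w assume "w \<in> ball y (rad j)"
        with y dist_triangle[of x w y] have "w \<in> ball x (rad j + t)" by simp
        with t(2) show "w \<in> Y" by blast
      qed
    qed
    \<comment> \<open>Reverse Fatou with the constant majorant \<open>bnd (rad j)\<close>, which is
      integrable over a probability space.\<close>
    also have "\<dots> \<le> bavg (rad m) (L j) x"
      unfolding bavg_def[of "rad m"] L_def
      by (rule nn_integral_limsup[where w="\<lambda>_. ennreal (bnd (rad j))"])
         (auto simp: bavg_le_bnd rad_pos)
    also have "\<dots> \<le> bavg (rad m) (\<lambda>_. L j x + ennreal e) x"
      using elim by (intro bavg_mono rad_pos s(2)) auto
    finally show ?case by simp
  qed
  then show "U x \<le> L j x + ennreal e"
    unfolding U_def by (rule Limsup_bounded)
qed

lemma eventually_cball_subset: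
  assumes "x \<in> Y"
  shows "\<forall>\<^sub>F m in sequentially. cball x (rad m) \<subseteq> Y"
proof -
  obtain e where "e > 0" "ball x e \<subseteq> Y" using open_Y assms by (meson open_contains_ball)
  then show ?thesis
    by (intro eventually_mono[OF eventually_rad_less[of e]]) (auto simp: subset_iff)
qed

lemma limsup_le_U:
  assumes "x \<in> Y"
  shows "limsup (\<lambda>n. p n x) \<le> U x"
proof -
  have "\<forall>\<^sub>F m in sequentially. limsup (\<lambda>n. p n x) \<le> L m x"
    using eventually_cball_subset[OF assms]
  proof eventually_elim
    case (elim m)
    then have "ball x (rad m) \<subseteq> Y" using ball_subset_cball by blast
    then show ?case unfolding L_def by (intro Limsup_mono always_eventually allI le_bavg rad_pos)
  qed
  then have "limsup (\<lambda>n. p n x) \<le> liminf (\<lambda>m. L m x)" by (rule Liminf_bounded)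
  also have "\<dots> \<le> U x" unfolding U_def by (rule Liminf_le_Limsup) simp
  finally show ?thesis .
qed

lemma U_finite: "x \<in> Y \<Longrightarrow> U x < top"
  using eventually_happens'[OF sequentially_bot eventually_cball_subset[of x]]
    U_le_L L_le_bnd le_less_trans[OF order_trans ennreal_less_top] by meson

text \<open>A single \<open>m\<close> already has \<open>L m x < a\<close>; this mean is upper
  semicontinuous at \<open>x\<close>, and by \<open>U_le_L\<close> it dominates \<open>U\<close> at
  all centres near \<open>x\<close>.\<close>

lemma U_usc:
  assumes x: "x \<in> Y" and a: "U x < a"
  obtains s where "s > 0" "\<And>q. dist x q < s \<Longrightarrow> U q < a"
proof -
  obtain b where b: "U x < b" "b < a" using dense[OF a] by blast
  have "\<forall>\<^sub>F m in sequentially. L m x < b"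
    using b(1) unfolding U_def by (rule Limsup_lessD)
  with eventually_cball_subset[OF x]
  have "\<forall>\<^sub>F m in sequentially. cball x (rad m) \<subseteq> Y \<and> L m x < b" by eventually_elim simp
  then obtain m where m: "cball x (rad m) \<subseteq> Y" "L m x < b"
    using eventually_happens'[OF sequentially_bot] by blast
  obtain e where e: "e > 0" "L m x + ennreal e < a"
  proof -
    have "b - L m x > 0" using m(2) by (simp add: diff_gr0_ennreal)
    then obtain c where c: "0 < c" "c < b - L m x" using dense by blast
    then obtain e where e: "0 < ennreal e" "ennreal e < b - L m x"
      by (cases c) auto
    have "L m x < top" using m(2) top.not_eq_extremum by fastforce
    then have "L m x + ennreal e \<le> b"
      using e(2) m(2) by (metis add_left_mono less_imp_le add_diff_inverse_ennreal)
    with b(2) e(1) show thesis by (intro that[of e]) auto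
  qed
  obtain t where t: "t > 0" "ball x (rad m + t) \<subseteq> Y"
    using cball_subset_open_enlarge[OF open_Y m(1)] rad_pos[of m] by auto
  obtain s where s: "s > 0" "\<And>q. dist x q < s \<Longrightarrow> L m q \<le> L m x + ennreal e"
    using L_usc[OF m(1) e(1)] by auto
  show thesis
  proof (rule that[of "min s t"])
    fix q assume q: "dist x q < min s t"
    have "cball q (rad m) \<subseteq> Y"
    proof
      fix w assume "w \<in> cball q (rad m)"
      with q dist_triangle[of x w q] have "w \<in> ball x (rad m + t)" by simp
      with t(2) show "w \<in> Y" by blast
    qed
    then have "U q \<le> L m q" by (rule U_le_L)
    also have "\<dots> \<le> L m x + ennreal e" using q by (intro s(2)) simp
    also note e(2)
    finally show "U q < a" .
  qed (use s t in simp)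
qed

text \<open>Two applications of reverse Fatou: the first, in \<open>n\<close>, gives the inequality
  for \<open>L m\<close> because ball and sphere means commute; the second, in \<open>m\<close>,
  gives it for \<open>U\<close>.\<close>

lemma U_submean:
  assumes r: "r > 0" and x: "cball x r \<subseteq> Y"
  shows "U x \<le> smean r U x"
proof -
  obtain t where t: "t > 0" "ball x (r + t) \<subseteq> Y"
    using cball_subset_open_enlarge[OF open_Y x] r by auto
  \<comment> \<open>The majorant must not depend on the radius of the inner mean. The bound
    \<open>bnd (rad m)\<close> grows without limit in \<open>m\<close> when \<open>C > 0\<close>, so
    it could not serve in the limsup over \<open>m\<close>.\<close>
  define M where "M = bnd (t / 2)"
  have bd: "bavg s (p n) y \<le> ennreal M" if "dist x y \<le> r" "0 < s" "s < t / 2" for n y s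
  proof -
    have "bavg s (p n) y \<le> bavg s (\<lambda>_. ennreal M) y"
      unfolding M_def
    proof (intro bavg_mono le_bnd)
      fix v assume v: "v \<in> ball y s"
      show "ball v (t / 2) \<subseteq> Y"
      proof
        fix w assume "w \<in> ball v (t / 2)"
        then have "w \<in> ball x (r + t)"
          using v that dist_triangle[of x w y] dist_triangle[of y w v] by simp
        with t(2) show "w \<in> Y" by blast
      qed
    qed (use t that in auto)
    then show ?thesis by simp
  qed
  obtain N where N: "\<And>m. m \<ge> N \<Longrightarrow> rad m < t / 2"
    using eventually_rad_less[of "t / 2"] t(1) by (auto simp: eventually_sequentially)
  have on_sphere: "dist x (x + r *\<^sub>R sgn z) \<le> r" for z :: 'a
    using r by (simp add: dist_norm norm_sgn)
  have L: "L m x \<le> smean r (L m) x" if "m \<ge> N" for m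
  proof -
    have "L m x \<le> limsup (\<lambda>n. bavg (rad m) (smean r (p n)) x)"
      unfolding L_def
    proof (intro Limsup_mono always_eventually allI bavg_mono rad_pos submean r)
      fix n y assume y: "y \<in> ball x (rad m)"
      show "cball y r \<subseteq> Y"
      proof
        fix w assume "w \<in> cball y r"
        with y N[OF that] t(1) dist_triangle[of x w y] have "w \<in> ball x (r + t)" by simp
        with t(2) show "w \<in> Y" by blast
      qed
    qed
    also have "\<dots> = limsup (\<lambda>n. smean r (bavg (rad m) (p n)) x)"
      by (simp add: bavg_smean_commute)
    also have "\<dots> \<le> smean r (L m) x"
      unfolding smean_def L_def
      by (rule nn_integral_limsup[where w="\<lambda>_. ennreal M"])
         (auto intro!: bd on_sphere rad_pos N that)
    finally show ?thesis .
  qed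
  have "U x = limsup (\<lambda>m. L (m + N) x)"
    unfolding U_def by (rule limsup_shift_k[symmetric])
  also have "\<dots> \<le> limsup (\<lambda>m. smean r (L (m + N)) x)"
    by (intro Limsup_mono always_eventually allI L) simp
  also have "\<dots> \<le> (\<integral>\<^sup>+z. limsup (\<lambda>m. L (m + N) (x + r *\<^sub>R sgn z)) \<partial>unit_ball_measure)"
    unfolding smean_def
  proof (rule nn_integral_limsup[where w="\<lambda>_. ennreal M"])
    fix m
    show "AE z in unit_ball_measure. L (m + N) (x + r *\<^sub>R sgn z) \<le> ennreal M"
      unfolding L_def
      by (intro AE_I2 Limsup_bounded always_eventually allI bd on_sphere rad_pos N) simp
  qed auto
  also have "\<dots> = smean r U x"
    unfolding smean_def U_def using limsup_shift_k[of "\<lambda>m. L m _" N] by simp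
  finally show ?thesis .
qed

end

section \<open>Weighted integrals of the limit\<close>

lemma liminf_superadditive:
  fixes a b :: "nat \<Rightarrow> ennreal"
  shows "liminf a + liminf b \<le> liminf (\<lambda>n. a n + b n)"
proof -
  have "liminf a + liminf b = (SUP n. (INF m\<in>{n..}. a m) + (INF m\<in>{n..}. b m))"
    unfolding liminf_SUP_INF
    by (rule ennreal_SUP_add[symmetric]) (auto simp: incseq_def intro!: INF_superset_mono)
  also have "\<dots> \<le> liminf (\<lambda>n. a n + b n)"
    unfolding liminf_SUP_INF
    by (intro SUP_mono' INF_greatest add_mono INF_lower)
  finally show ?thesis .
qed

lemma liminf_cmult_le:
  fixes a :: "nat \<Rightarrow> ennreal"
  shows "c * liminf a \<le> liminf (\<lambda>n. c * a n)"
proof -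
  have "c * liminf a = (SUP n. c * (INF m\<in>{n..}. a m))"
    unfolding liminf_SUP_INF by (rule SUP_mult_left_ennreal)
  also have "\<dots> \<le> liminf (\<lambda>n. c * a n)"
    unfolding liminf_SUP_INF
    by (intro SUP_mono' INF_greatest mult_left_mono INF_lower) auto
  finally show ?thesis .
qed

text \<open>By Fubini the left-hand side averages, over \<open>z\<close> in the unit ball, the
  integrals of \<open>f\<close> over the translates of \<open>K\<close> by
  \<open>r *\<^sub>R z\<close>, each contained in \<open>V\<close>.\<close>

lemma nn_integral_bavg_on_le:
  fixes f :: "'a::euclidean_space \<Rightarrow> ennreal"
  assumes [measurable]: "f \<in> borel_measurable borel" "K \<in> sets borel" "V \<in> sets borel"
    and V: "\<And>x z. x \<in> K \<Longrightarrow> norm z < 1 \<Longrightarrow> x + r *\<^sub>R z \<in> V"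
  shows "(\<integral>\<^sup>+y. bavg r f y * indicator K y \<partial>lborel) \<le> (\<integral>\<^sup>+y. f y * indicator V y \<partial>lborel)"
proof -
  interpret P: pair_sigma_finite "lborel :: 'a measure" "unit_ball_measure :: 'a measure" ..
  have m: "(\<lambda>(y, z). f (y + r *\<^sub>R z) * indicator K y) \<in> borel_measurable (lborel \<Otimes>\<^sub>M unit_ball_measure)"
    by measurable
  have "(\<integral>\<^sup>+y. bavg r f y * indicator K y \<partial>lborel)
      = (\<integral>\<^sup>+y. \<integral>\<^sup>+z. f (y + r *\<^sub>R z) * indicator K y \<partial>unit_ball_measure \<partial>lborel)"
    unfolding bavg_def by (intro nn_integral_cong nn_integral_multc[symmetric]) measurable
  also have "\<dots> = (\<integral>\<^sup>+z. \<integral>\<^sup>+y. f (y + r *\<^sub>R z) * indicator K y \<partial>lborel \<partial>unit_ball_measure)"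
    by (rule P.Fubini'[OF m, symmetric])
  also have "\<dots> \<le> (\<integral>\<^sup>+(z::'a). (\<integral>\<^sup>+y. f y * indicator V y \<partial>lborel) \<partial>unit_ball_measure)"
  proof (rule nn_integral_mono_AE, rule AE_mp[OF AE_unit_ball_measure], intro AE_I2 impI)
    fix z :: 'a assume z: "z \<in> ball 0 1"
    have "(\<integral>\<^sup>+y. f (y + r *\<^sub>R z) * indicator K y \<partial>lborel)
        \<le> (\<integral>\<^sup>+y. f (r *\<^sub>R z + 1 *\<^sub>R y) * indicator V (r *\<^sub>R z + 1 *\<^sub>R y) \<partial>lborel)"
      using V z by (intro nn_integral_mono) (auto simp: indicator_def add.commute)
    also have "\<dots> = (\<integral>\<^sup>+y. f y * indicator V y \<partial>lborel)"
      by (subst nn_integral_lborel_scale[of "\<lambda>y. f y * indicator V y" 1 "r *\<^sub>R z"]) auto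
    finally show "(\<integral>\<^sup>+y. f (y + r *\<^sub>R z) * indicator K y \<partial>lborel) \<le> (\<integral>\<^sup>+y. f y * indicator V y \<partial>lborel)" .
  qed
  also have "\<dots> = (\<integral>\<^sup>+y. f y * indicator V y \<partial>lborel)"
    by simp
  finally show ?thesis .
qed

context submean_sequence_conv
begin

text \<open>On \<open>K\<close> the function \<open>U\<close> is below the liminf of ball means, so
  Fatou applies. Integrating ball means over \<open>K\<close> reaches only a thin neighbourhood of
  \<open>K\<close>, and outer regularity makes the excess volume small while \<open>p n\<close>
  stays below \<open>M\<close> there.\<close>

lemma nn_integral_U_compact:
  assumes K: "compact K" "K \<subseteq> Y"
  shows "(\<integral>\<^sup>+y. U y * indicator K y \<partial>lborel) \<le> liminf (\<lambda>n. \<integral>\<^sup>+y. p n y * indicator K y \<partial>lborel)"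
proof (rule ennreal_le_epsilon)
  fix e :: real assume e: "0 < e"
  have [measurable]: "K \<in> sets borel" using K(1) by (rule borel_compact)
  obtain t where t: "t > 0" "(\<Union>x\<in>K. ball x t) \<subseteq> Y"
    using compact_subset_open_imp_ball_epsilon_subset[OF K(1) open_Y K(2)] .
  define M where "M = bnd (t / 2)"
  have M: "M \<ge> 0" by (simp add: M_def bnd_nonneg)
  have KL: "K \<in> sets lebesgue" by (simp add: sets_completionI_sets)
  \<comment> \<open>The excess contributes at most \<open>M\<close> times its volume, hence at most
    \<open>e\<close>; \<open>M + 1\<close> avoids dividing by \<open>M = 0\<close>.\<close>
  have "e / (M + 1) > 0" using e M by simp
  then obtain T where T: "open T" "K \<subseteq> T" "emeasure lebesgue (T - K) < ennreal (e / (M + 1))"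
    using sets_lebesgue_outer_open[OF KL] by blast
  have [measurable]: "T \<in> sets borel" using T(1) by simp
  have TK: "emeasure lborel (T - K) \<le> ennreal (e / (M + 1))"
    using T(3) by (simp add: less_imp_le)
  obtain s where s: "s > 0" "(\<Union>x\<in>K. ball x s) \<subseteq> T"
    using compact_subset_open_imp_ball_epsilon_subset[OF K(1) T(1,2)] .
  \<comment> \<open>\<open>rad m < s\<close> keeps the neighbourhood \<open>V\<close> inside
    \<open>T\<close>; \<open>rad m < t / 2\<close> leaves each of its points a ball of radius
    \<open>t / 2\<close> in \<open>Y\<close>, where the bound \<open>M\<close> is valid.\<close>
  obtain m where m: "rad m < min s (t / 2)"
    using eventually_happens'[OF sequentially_bot eventually_rad_less[of "min s (t / 2)"]] s t by auto
  define V where "V = (\<Union>x\<in>K. ball x (rad m))"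
  have "open V" by (auto simp: V_def)
  then have [measurable]: "V \<in> sets borel" by simp
  have V: "x + rad m *\<^sub>R z \<in> V" if "x \<in> K" "norm z < 1" for x z
    unfolding V_def using that rad_pos[of m] by (intro UN_I[of x]) (auto simp: dist_norm)
  have "(\<integral>\<^sup>+y. U y * indicator K y \<partial>lborel) \<le> (\<integral>\<^sup>+y. liminf (\<lambda>n. bavg (rad m) (p n) y * indicator K y) \<partial>lborel)"
  proof (intro nn_integral_mono)
    fix y
    show "U y * indicator K y \<le> liminf (\<lambda>n. bavg (rad m) (p n) y * indicator K y)"
    proof (cases "y \<in> K")
      case True
      have "cball y (rad m) \<subseteq> ball y t" using m t(1) by auto
      with True t(2) have "cball y (rad m) \<subseteq> Y" by blast
      with True show ?thesis
        using order_trans[OF U_le_L L_le_liminf, of y m] by simp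
    qed simp
  qed
  also have "\<dots> \<le> liminf (\<lambda>n. \<integral>\<^sup>+y. bavg (rad m) (p n) y * indicator K y \<partial>lborel)"
    by (rule nn_integral_liminf) measurable
  also have "\<dots> \<le> liminf (\<lambda>n. \<integral>\<^sup>+y. p n y * indicator K y \<partial>lborel) + ennreal e"
  proof (rule liminf_le_liminf_plus)
    fix n
    have "(\<integral>\<^sup>+y. bavg (rad m) (p n) y * indicator K y \<partial>lborel) \<le> (\<integral>\<^sup>+y. p n y * indicator V y \<partial>lborel)"
      using V by (intro nn_integral_bavg_on_le) auto
    also have "\<dots> \<le> (\<integral>\<^sup>+y. p n y * indicator K y + ennreal M * indicator (T - K) y \<partial>lborel)"
    proof (rule nn_integral_mono)
      fix y
      show "p n y * indicator V y \<le> p n y * indicator K y + ennreal M * indicator (T - K) y"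
      proof (cases "y \<in> V \<and> y \<notin> K")
        case True
        then obtain x where x: "x \<in> K" "dist x y < rad m" by (auto simp: V_def)
        have "y \<in> ball x s" using x m by simp
        with s(2) x(1) have "y \<in> T" by blast
        have "ball y (t / 2) \<subseteq> ball x t"
        proof
          fix w assume "w \<in> ball y (t / 2)"
          then show "w \<in> ball x t" using x m dist_triangle[of x w y] by simp
        qed
        with t(2) x(1) have "ball y (t / 2) \<subseteq> Y" by blast
        then have "p n y \<le> ennreal M" unfolding M_def using t(1) by (intro le_bnd) auto
        with True \<open>y \<in> T\<close> show ?thesis by simp
      qed (auto simp: indicator_def)
    qed
    also have "\<dots> = (\<integral>\<^sup>+y. p n y * indicator K y \<partial>lborel) + ennreal M * emeasure lborel (T - K)"
      by (subst nn_integral_add) (auto simp: nn_integral_cmult)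
    also have "ennreal M * emeasure lborel (T - K) \<le> ennreal M * ennreal (e / (M + 1))"
      by (intro mult_left_mono TK) simp
    also have "\<dots> = ennreal (M * (e / (M + 1)))"
      using M e by (intro ennreal_mult[symmetric]) auto
    also have "\<dots> \<le> ennreal e"
      using M e by (intro ennreal_leI) (simp add: field_simps)
    finally show "(\<integral>\<^sup>+y. bavg (rad m) (p n) y * indicator K y \<partial>lborel)
        \<le> (\<integral>\<^sup>+y. p n y * indicator K y \<partial>lborel) + ennreal e"
      by (simp add: add_left_mono)
  qed
  finally show "(\<integral>\<^sup>+y. U y * indicator K y \<partial>lborel)
      \<le> liminf (\<lambda>n. \<integral>\<^sup>+y. p n y * indicator K y \<partial>lborel) + ennreal e" .
qed

text \<open>The measure with density \<open>U\<close> on \<open>Y\<close> is finite, hence inner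
  regular, so the estimate for compact subsets of \<open>B\<close> suffices.\<close>

lemma nn_integral_U_borel:
  assumes B [measurable]: "B \<in> sets borel" and "B \<subseteq> Y"
  shows "(\<integral>\<^sup>+y. U y * indicator B y \<partial>lborel) \<le> liminf (\<lambda>n. \<integral>\<^sup>+y. p n y * indicator B y \<partial>lborel)"
proof -
  have [measurable]: "Y \<in> sets borel" using open_Y by simp
  define M where "M = density lborel (\<lambda>y. U y * indicator Y y)"
  have M: "emeasure M A = (\<integral>\<^sup>+y. U y * indicator A y \<partial>lborel)" if "A \<in> sets borel" "A \<subseteq> Y" for A
    unfolding M_def using that
    by (subst emeasure_density) (auto intro!: nn_integral_cong simp: indicator_def)
  obtain K :: "nat \<Rightarrow> 'a set" where K: "\<And>n. compact (K n)" "\<And>n. K n \<subseteq> Y"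
      and K3: "\<And>k. compact k \<Longrightarrow> k \<subseteq> Y \<Longrightarrow> \<exists>N. \<forall>n\<ge>N. k \<subseteq> K n"
    using open_Union_compact_subsets[OF open_Y] by metis
  have [measurable]: "K n \<in> sets borel" for n using K(1) by (rule borel_compact)
  \<comment> \<open>Inner regularity is available for finite measures. Finiteness follows from Fatou
    along the compact exhaustion, each piece having mass at most \<open>C\<close>.\<close>
  have "emeasure M UNIV = (\<integral>\<^sup>+y. U y * indicator Y y \<partial>lborel)"
    unfolding M_def by (subst emeasure_density) auto
  also have "\<dots> \<le> (\<integral>\<^sup>+y. liminf (\<lambda>i. U y * indicator (K i) y) \<partial>lborel)"
  proof (rule nn_integral_mono)
    fix y
    show "U y * indicator Y y \<le> liminf (\<lambda>i. U y * indicator (K i) y)"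
    proof (cases "y \<in> Y")
      case True
      then obtain N where "\<forall>n\<ge>N. {y} \<subseteq> K n" using K3[of "{y}"] by auto
      then have "\<forall>\<^sub>F i in sequentially. U y \<le> U y * indicator (K i) y"
        unfolding eventually_sequentially by (intro exI[of _ N]) auto
      then show ?thesis using True by (auto intro!: Liminf_bounded)
    qed simp
  qed
  also have "\<dots> \<le> liminf (\<lambda>i. \<integral>\<^sup>+y. U y * indicator (K i) y \<partial>lborel)"
    by (rule nn_integral_liminf) measurable
  also have "\<dots> \<le> liminf (\<lambda>i. ennreal C)"
  proof (intro Liminf_mono always_eventually allI)
    fix i
    have "(\<integral>\<^sup>+y. U y * indicator (K i) y \<partial>lborel) \<le> liminf (\<lambda>n. \<integral>\<^sup>+y. p n y * indicator (K i) y \<partial>lborel)"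
      by (rule nn_integral_U_compact[OF K(1,2)])
    also have "\<dots> \<le> limsup (\<lambda>n. \<integral>\<^sup>+y. p n y * indicator (K i) y \<partial>lborel)"
      by (rule Liminf_le_Limsup) simp
    also have "\<dots> \<le> ennreal C"
    proof (intro Limsup_bounded always_eventually allI)
      fix n
      have "(\<integral>\<^sup>+y. p n y * indicator (K i) y \<partial>lborel) \<le> (\<integral>\<^sup>+y. p n y \<partial>lborel)"
        by (rule nn_integral_mono) (auto simp: indicator_def)
      also note mass
      finally show "(\<integral>\<^sup>+y. p n y * indicator (K i) y \<partial>lborel) \<le> ennreal C" .
    qed
    finally show "(\<integral>\<^sup>+y. U y * indicator (K i) y \<partial>lborel) \<le> ennreal C" .
  qed
  finally have "emeasure M UNIV \<le> ennreal C" by (simp add: Liminf_const)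
  then have fin: "emeasure M (space M) \<noteq> \<infinity>" by (auto simp: M_def top_unique)
  have "(\<integral>\<^sup>+y. U y * indicator B y \<partial>lborel) = (SUP k\<in>{k. k \<subseteq> B \<and> compact k}. emeasure M k)"
    using inner_regular[OF _ fin B] M[OF B \<open>B \<subseteq> Y\<close>] by (simp add: M_def)
  also have "\<dots> \<le> liminf (\<lambda>n. \<integral>\<^sup>+y. p n y * indicator B y \<partial>lborel)"
  proof (rule SUP_least)
    fix k assume "k \<in> {k. k \<subseteq> B \<and> compact k}"
    then have k: "k \<subseteq> B" "compact k" by auto
    have "emeasure M k = (\<integral>\<^sup>+y. U y * indicator k y \<partial>lborel)"
      using k \<open>B \<subseteq> Y\<close> by (intro M) (auto intro: borel_compact)
    also have "\<dots> \<le> liminf (\<lambda>n. \<integral>\<^sup>+y. p n y * indicator k y \<partial>lborel)"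
      using k \<open>B \<subseteq> Y\<close> by (intro nn_integral_U_compact) auto
    also have "\<dots> \<le> liminf (\<lambda>n. \<integral>\<^sup>+y. p n y * indicator B y \<partial>lborel)"
      using k by (intro Liminf_mono always_eventually allI nn_integral_mono) (auto simp: indicator_def)
    finally show "emeasure M k \<le> liminf (\<lambda>n. \<integral>\<^sup>+y. p n y * indicator B y \<partial>lborel)" .
  qed
  finally show ?thesis .
qed

text \<open>Starting from indicators, the inequality survives sums and multiples because liminf is
  superadditive, and increasing limits because each stage lies below the final weight. The weight to
  come is the density of \<nu>, which may be unbounded.\<close>

lemma nn_integral_U_weight:
  assumes "h \<in> borel_measurable borel"
  shows "(\<integral>\<^sup>+y. U y * (h y * indicator Y y) \<partial>lborel) \<le> liminf (\<lambda>n. \<integral>\<^sup>+y. p n y * h y \<partial>lborel)"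
proof -
  have [measurable]: "Y \<in> sets borel" using open_Y by simp
  show ?thesis
    using assms
  proof (induction h rule: borel_measurable_induct)
    case (cong f g)
    then show ?case by simp
  next
    case (set A)
    then have [measurable]: "A \<in> sets borel" by simp
    have "(\<integral>\<^sup>+y. U y * (indicator A y * indicator Y y) \<partial>lborel) = (\<integral>\<^sup>+y. U y * indicator (A \<inter> Y) y \<partial>lborel)"
      by (intro nn_integral_cong) (auto simp: indicator_def)
    also have "\<dots> \<le> liminf (\<lambda>n. \<integral>\<^sup>+y. p n y * indicator (A \<inter> Y) y \<partial>lborel)"
      by (rule nn_integral_U_borel) auto
    \<comment> \<open>Since \<open>p n\<close> vanishes off \<open>Y\<close>, intersecting with
      \<open>Y\<close> does not change its integrals.\<close>
    also have "\<dots> = liminf (\<lambda>n. \<integral>\<^sup>+y. p n y * indicator A y \<partial>lborel)"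
      using outside by (intro arg_cong[where f=liminf] ext nn_integral_cong) (auto simp: indicator_def)
    finally show ?case .
  next
    case (mult u c)
    then have [measurable]: "u \<in> borel_measurable borel" by simp
    have "(\<integral>\<^sup>+y. U y * (c * u y * indicator Y y) \<partial>lborel) = c * (\<integral>\<^sup>+y. U y * (u y * indicator Y y) \<partial>lborel)"
      by (subst nn_integral_cmult[symmetric]) (auto intro!: nn_integral_cong simp: mult_ac)
    also have "\<dots> \<le> c * liminf (\<lambda>n. \<integral>\<^sup>+y. p n y * u y \<partial>lborel)"
      by (intro mult_left_mono mult.IH) simp
    also have "\<dots> \<le> liminf (\<lambda>n. c * (\<integral>\<^sup>+y. p n y * u y \<partial>lborel))"
      by (rule liminf_cmult_le)
    also have "\<dots> = liminf (\<lambda>n. \<integral>\<^sup>+y. p n y * (c * u y) \<partial>lborel)"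
      by (subst nn_integral_cmult[symmetric]) (auto simp: mult_ac)
    finally show ?case .
  next
    case (add u v)
    then have [measurable]: "u \<in> borel_measurable borel" "v \<in> borel_measurable borel" by simp_all
    have "(\<integral>\<^sup>+y. U y * ((v y + u y) * indicator Y y) \<partial>lborel) =
        (\<integral>\<^sup>+y. U y * (v y * indicator Y y) \<partial>lborel) + (\<integral>\<^sup>+y. U y * (u y * indicator Y y) \<partial>lborel)"
      by (subst nn_integral_add[symmetric]) (auto simp: distrib_left distrib_right)
    also have "\<dots> \<le> liminf (\<lambda>n. \<integral>\<^sup>+y. p n y * v y \<partial>lborel) + liminf (\<lambda>n. \<integral>\<^sup>+y. p n y * u y \<partial>lborel)"
      by (intro add_mono add.IH)
    also have "\<dots> \<le> liminf (\<lambda>n. (\<integral>\<^sup>+y. p n y * v y \<partial>lborel) + (\<integral>\<^sup>+y. p n y * u y \<partial>lborel))"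
      by (rule liminf_superadditive)
    also have "\<dots> = liminf (\<lambda>n. \<integral>\<^sup>+y. p n y * (v y + u y) \<partial>lborel)"
      by (subst nn_integral_add[symmetric]) (auto simp: distrib_left)
    finally show ?case .
  next
    case (seq H)
    then have [measurable]: "\<And>i. H i \<in> borel_measurable borel" by simp
    have inc: "incseq (\<lambda>i y. U y * (H i y * indicator Y y))"
      using \<open>incseq H\<close> by (auto simp: incseq_def le_fun_def intro!: mult_left_mono mult_right_mono)
    have "(\<integral>\<^sup>+y. U y * ((SUP i. H i) y * indicator Y y) \<partial>lborel) =
        (\<integral>\<^sup>+y. (SUP i. U y * (H i y * indicator Y y)) \<partial>lborel)"
      by (intro nn_integral_cong) (simp add: SUP_apply SUP_mult_left_ennreal SUP_mult_right_ennreal image_comp)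
    also have "\<dots> = (SUP i. \<integral>\<^sup>+y. U y * (H i y * indicator Y y) \<partial>lborel)"
      by (rule nn_integral_monotone_convergence_SUP[OF inc]) measurable
    also have "\<dots> \<le> liminf (\<lambda>n. \<integral>\<^sup>+y. p n y * (SUP i. H i) y \<partial>lborel)"
    proof (rule SUP_least)
      fix i
      have "(\<integral>\<^sup>+y. U y * (H i y * indicator Y y) \<partial>lborel) \<le> liminf (\<lambda>n. \<integral>\<^sup>+y. p n y * H i y \<partial>lborel)"
        by (rule seq.IH)
      also have "\<dots> \<le> liminf (\<lambda>n. \<integral>\<^sup>+y. p n y * (SUP i. H i) y \<partial>lborel)"
        by (intro Liminf_mono always_eventually allI nn_integral_mono mult_left_mono)
           (auto simp: SUP_apply intro: SUP_upper)
      finally show "(\<integral>\<^sup>+y. U y * (H i y * indicator Y y) \<partial>lborel)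
          \<le> liminf (\<lambda>n. \<integral>\<^sup>+y. p n y * (SUP i. H i) y \<partial>lborel)" .
    qed
    finally show ?case .
  qed
qed

text \<open>A compact set has a positive margin inside \<open>Y\<close>, so one radius serves all
  its points. This later yields Bochner integrability of the limit over spheres.\<close>

lemma U_bounded_compact:
  assumes K: "compact K" "K \<subseteq> Y"
  shows "\<exists>M::real. \<forall>x\<in>K. U x \<le> ennreal M"
proof -
  obtain t where t: "t > 0" "(\<Union>x\<in>K. ball x t) \<subseteq> Y"
    using compact_subset_open_imp_ball_epsilon_subset[OF K(1) open_Y K(2)] .
  obtain m where m: "rad m < t"
    using eventually_happens'[OF sequentially_bot eventually_rad_less[OF t(1)]] by auto
  have "U x \<le> ennreal (bnd (rad m))" if "x \<in> K" for x
  proof -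
    have "cball x (rad m) \<subseteq> ball x t" using m by auto
    with t(2) that have "cball x (rad m) \<subseteq> Y" by blast
    then show ?thesis using U_le_L L_le_bnd order_trans by blast
  qed
  then show ?thesis by blast
qed

end

lemma (in submean_sequence) compactness:
  obtains k V where "strict_mono (k :: nat \<Rightarrow> nat)" "V \<in> borel_measurable borel"
    "\<And>x. x \<in> Y \<Longrightarrow> V x < top"
    "\<And>K. compact K \<Longrightarrow> K \<subseteq> Y \<Longrightarrow> \<exists>M::real. \<forall>x\<in>K. V x \<le> ennreal M"
    "\<And>x a. x \<in> Y \<Longrightarrow> V x < a \<Longrightarrow> \<exists>s>0. \<forall>q. dist x q < s \<longrightarrow> V q < a"
    "\<And>x r. r > 0 \<Longrightarrow> cball x r \<subseteq> Y \<Longrightarrow> V x \<le> smean r V x"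
    "\<And>x. x \<in> Y \<Longrightarrow> limsup (\<lambda>n. p (k n) x) \<le> V x"
    "\<And>h. h \<in> borel_measurable borel \<Longrightarrow>
      (\<integral>\<^sup>+y. V y * (h y * indicator Y y) \<partial>lborel) \<le> liminf (\<lambda>n. \<integral>\<^sup>+y. p (k n) y * h y \<partial>lborel)"
proof -
  obtain D :: "'a set" where D: "countable D" "\<And>S. open S \<Longrightarrow> S \<noteq> {} \<Longrightarrow> \<exists>d\<in>D. d \<in> S"
    using countable_dense_setE by blast
  obtain k where k: "strict_mono (k :: nat \<Rightarrow> nat)"
    "\<And>q m. q \<in> D \<Longrightarrow> convergent (\<lambda>n. bavg (rad m) (p (k n)) q)"
    by (rule convergent_subsequence[OF D(1)]) blast
  interpret S: submean_sequence Y "\<lambda>n. p (k n)" C by (rule subsequence)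
  interpret S: submean_sequence_conv Y "\<lambda>n. p (k n)" C D
    by unfold_locales (use D(2) k(2) in auto)
  show thesis
  proof (rule that[OF k(1) S.measurable_U])
    show "\<exists>s>0. \<forall>q. dist x q < s \<longrightarrow> S.U q < a" if "x \<in> Y" "S.U x < a" for x a
      using S.U_usc[OF that] by metis
  qed (use S.U_finite S.U_bounded_compact S.U_submean S.limsup_le_U S.nn_integral_U_weight in auto)
qed

section \<open>Subharmonic functions and the quadratic transform\<close>

text \<open>The bridge between \<open>ennreal\<close> means and the real integrals in
  \<open>subharmonic_on\<close>. Agreement of \<open>f\<close> and \<open>F\<close> on the closed
  ball is enough, so \<open>f\<close> may be the extension by 0 of a function on
  \<open>Y\<close>.\<close>

lemma smean_eq_sphere_mean:
  fixes f :: "'a::euclidean_space \<Rightarrow> ennreal"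
  assumes f [measurable]: "f \<in> borel_measurable borel" and r: "r \<ge> 0"
    and eq: "\<And>y. y \<in> cball x r \<Longrightarrow> f y = ennreal (F y)"
    and nonneg: "\<And>y. y \<in> cball x r \<Longrightarrow> 0 \<le> F y"
    and int: "set_integrable lborel (ball 0 1) (sphere_fun F x r)"
  shows "smean r f x = ennreal ((\<integral>z\<in>ball 0 1. sphere_fun F x r z \<partial>lborel) / measure lborel (ball (0::'a) 1))"
    and "0 \<le> (\<integral>z\<in>ball 0 1. sphere_fun F x r z \<partial>lborel)"
proof -
  have mem: "x + r *\<^sub>R sgn z \<in> cball x r" for z :: 'a
    using r by (simp add: dist_norm norm_sgn)
  have sf: "sphere_fun F x r z = F (x + r *\<^sub>R sgn z)" for z
    by (simp add: sphere_fun_def sgn_div_norm)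
  have sf_nonneg: "0 \<le> sphere_fun F x r z" for z
    using nonneg[OF mem] by (simp add: sf)
  have pos: "measure lborel (ball (0::'a) 1) > 0" by (rule content_ball_pos) simp
  show int_nonneg: "0 \<le> (\<integral>z\<in>ball 0 1. sphere_fun F x r z \<partial>lborel)"
    unfolding set_lebesgue_integral_def
    by (intro integral_nonneg_AE AE_I2) (simp add: sf_nonneg)
  have "smean r f x = (\<integral>\<^sup>+z. f (x + r *\<^sub>R sgn z) * indicator (ball 0 1) z \<partial>lborel) / emeasure lborel (ball (0::'a) 1)"
    unfolding smean_def by (rule nn_integral_unit_ball_measure) measurable
  also have "(\<integral>\<^sup>+z. f (x + r *\<^sub>R sgn z) * indicator (ball 0 1) z \<partial>lborel)
      = (\<integral>\<^sup>+z. ennreal (indicator (ball 0 1) z *\<^sub>R sphere_fun F x r z) \<partial>lborel)"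
    by (intro nn_integral_cong) (use eq[OF mem] in \<open>auto simp: sf indicator_def\<close>)
  also have "\<dots> = ennreal (\<integral>z\<in>ball 0 1. sphere_fun F x r z \<partial>lborel)"
    unfolding set_lebesgue_integral_def
    by (rule nn_integral_eq_integral[OF int[unfolded set_integrable_def]])
       (simp add: sf_nonneg)
  also have "\<dots> / emeasure lborel (ball (0::'a) 1) =
      ennreal ((\<integral>z\<in>ball 0 1. sphere_fun F x r z \<partial>lborel) / measure lborel (ball (0::'a) 1))"
    using pos int_nonneg by (simp add: emeasure_ball_eq divide_ennreal)
  finally show "smean r f x = ennreal ((\<integral>z\<in>ball 0 1. sphere_fun F x r z \<partial>lborel) / measure lborel (ball (0::'a) 1))" .
qed

lemma subharmonic_on_zero: "subharmonic_on U (\<lambda>_. 0)"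
proof -
  have "sphere_fun (\<lambda>_. 0) x0 r = (\<lambda>_. 0)" for x0 :: 'a and r
    by (simp add: sphere_fun_def)
  then show ?thesis by (simp add: subharmonic_on_def usc_on_def set_integrable_def)
qed

lemma subharmonic_on_cmult:
  assumes "subharmonic_on U f" "t \<ge> 0"
  shows "subharmonic_on U (\<lambda>x. t * f x)"
proof (cases "t = 0")
  case True
  then show ?thesis by (simp add: subharmonic_on_zero)
next
  case False
  then have t: "t > 0" using assms by simp
  have sf: "sphere_fun (\<lambda>x. t * f x) x0 r = (\<lambda>x. t * sphere_fun f x0 r x)" for x0 r
    by (simp add: sphere_fun_def)
  show ?thesis
    unfolding subharmonic_on_def
  proof (intro conjI allI impI)
    show "usc_on U (\<lambda>x. t * f x)"
      unfolding usc_on_def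
    proof (intro ballI allI impI)
      fix x and e :: real assume "x \<in> U" "e > 0"
      then have "\<forall>\<^sub>F y in at x within U. f y < f x + e / t"
        using assms(1) t by (auto simp: subharmonic_on_def usc_on_def)
      then show "\<forall>\<^sub>F y in at x within U. t * f y < t * f x + e"
        by eventually_elim (use t in \<open>simp add: field_simps\<close>)
    qed
  next
    fix x0 r assume "0 < r \<and> cball x0 r \<subseteq> U"
    then have *: "set_integrable lborel (ball 0 1) (sphere_fun f x0 r)"
      "f x0 \<le> (\<integral>x\<in>ball 0 1. sphere_fun f x0 r x \<partial>lborel) / measure lborel (ball (0::'a) 1)"
      using assms(1) by (auto simp: subharmonic_on_def)
    then show "set_integrable lborel (ball 0 1) (sphere_fun (\<lambda>x. t * f x) x0 r)"
      unfolding sf by simp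
    show "t * f x0 \<le> (\<integral>x\<in>ball 0 1. sphere_fun (\<lambda>x. t * f x) x0 r x \<partial>lborel) / measure lborel (ball (0::'a) 1)"
      unfolding sf using mult_left_mono[OF *(2), of t] t by simp
  qed
qed

lemma subharmonic_on_diff_const:
  fixes f :: "'a::euclidean_space \<Rightarrow> real"
  assumes "subharmonic_on U f"
  shows "subharmonic_on U (\<lambda>x. f x - c)"
proof -
  have sf: "sphere_fun (\<lambda>x. f x - c) x0 r = (\<lambda>x. sphere_fun f x0 r x - c)" for x0 r
    by (simp add: sphere_fun_def)
  have c: "set_integrable lborel (ball (0::'a) 1) (\<lambda>_. c)"
    unfolding set_integrable_def using emeasure_lborel_ball_finite[of "0::'a" 1] by simp
  have pos: "measure lborel (ball (0::'a) 1) > 0" by (rule content_ball_pos) simp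
  have ci: "(\<integral>x\<in>ball (0::'a) 1. c \<partial>lborel) = c * measure lborel (ball (0::'a) 1)"
    unfolding set_lebesgue_integral_def using emeasure_lborel_ball_finite[of "0::'a" 1] by simp
  show ?thesis
    unfolding subharmonic_on_def
  proof (intro conjI allI impI)
    show "usc_on U (\<lambda>x. f x - c)"
      using assms by (simp add: subharmonic_on_def usc_on_def algebra_simps)
  next
    fix x0 r assume "0 < r \<and> cball x0 r \<subseteq> U"
    then have *: "set_integrable lborel (ball 0 1) (sphere_fun f x0 r)"
      "f x0 \<le> (\<integral>x\<in>ball 0 1. sphere_fun f x0 r x \<partial>lborel) / measure lborel (ball (0::'a) 1)"
      using assms(1) by (auto simp: subharmonic_on_def)
    then show "set_integrable lborel (ball 0 1) (sphere_fun (\<lambda>x. f x - c) x0 r)"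
      unfolding sf using c by (intro set_integral_diff)
    show "f x0 - c \<le> (\<integral>x\<in>ball 0 1. sphere_fun (\<lambda>x. f x - c) x0 r x \<partial>lborel) / measure lborel (ball (0::'a) 1)"
      unfolding sf set_integral_diff(2)[OF *(1) c] ci using *(2) pos by (simp add: field_simps)
  qed
qed

section \<open>The quadratic transform\<close>

lemma Q2_less_iff:
  assumes "Y \<noteq> {}" "\<And>y. y \<in> Y \<Longrightarrow> b \<le> \<psi> y"
  shows "Q2 Y \<psi> x < a \<longleftrightarrow> (\<exists>y\<in>Y. \<psi> y + (norm (x - y))\<^sup>2 < a)"
  unfolding Q2_def
proof (rule cINF_less_iff[OF assms(1)])
  \<comment> \<open>A real infimum is meaningful only with a lower bound; \<open>b\<close> is one
    because the quadratic term is nonnegative.\<close>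
  show "bdd_below ((\<lambda>y. \<psi> y + (norm (x - y))\<^sup>2) ` Y)"
    using assms(2) by (intro bdd_belowI2[of _ b]) (simp add: add_increasing2)
qed

lemma Q2_le:
  assumes "\<And>y. y \<in> Y \<Longrightarrow> b \<le> \<psi> y" "y \<in> Y"
  shows "Q2 Y \<psi> x \<le> \<psi> y + (norm (x - y))\<^sup>2"
  using Q2_less_iff[of Y b \<psi> x "\<psi> y + (norm (x - y))\<^sup>2"] Q2_less_iff[of Y b \<psi> x "Q2 Y \<psi> x"] assms
  by (metis empty_iff less_irrefl not_le)

lemma Q2_nonneg:
  assumes "Y \<noteq> {}" "\<And>y. y \<in> Y \<Longrightarrow> 0 \<le> \<psi> y"
  shows "0 \<le> Q2 Y \<psi> x"
  unfolding Q2_def using assms by (intro cINF_greatest) auto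

lemma Q2_diff_const:
  assumes "Y \<noteq> {}" "\<And>y. y \<in> Y \<Longrightarrow> b \<le> \<psi> y"
  shows "Q2 Y (\<lambda>y. \<psi> y - c) x = Q2 Y \<psi> x - c"
proof -
  have "Q2 Y (\<lambda>y. \<psi> y - c) x < a \<longleftrightarrow> Q2 Y \<psi> x - c < a" for a
  proof -
    have "Q2 Y (\<lambda>y. \<psi> y - c) x < a \<longleftrightarrow> (\<exists>y\<in>Y. \<psi> y - c + (norm (x - y))\<^sup>2 < a)"
      using assms by (intro Q2_less_iff[of Y "b - c"]) auto
    also have "\<dots> \<longleftrightarrow> (\<exists>y\<in>Y. \<psi> y + (norm (x - y))\<^sup>2 < a + c)"
      by (simp add: algebra_simps)
    also have "\<dots> \<longleftrightarrow> Q2 Y \<psi> x < a + c"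
      using assms by (intro Q2_less_iff[symmetric])
    finally show ?thesis by (simp add: algebra_simps)
  qed
  then show ?thesis by (meson less_irrefl linorder_less_linear)
qed

text \<open>An infimum of continuous functions of \<open>x\<close> has open strict sublevel sets,
  although the infimum is over an uncountable set.\<close>

lemma measurable_Q2:
  assumes "Y \<noteq> {}" "\<And>y. y \<in> Y \<Longrightarrow> b \<le> \<psi> y"
  shows "Q2 Y \<psi> \<in> borel_measurable borel"
proof (rule borel_measurableI_less)
  fix a
  have "{x. Q2 Y \<psi> x < a} = (\<Union>y\<in>Y. {x. \<psi> y + (norm (x - y))\<^sup>2 < a})"
    by (auto simp: Q2_less_iff[OF assms])
  also have "open \<dots>"
    by (intro open_UN ballI open_Collect_less continuous_intros)
  finally show "{x \<in> space borel. Q2 Y \<psi> x < a} \<in> sets borel" by simp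
qed

section \<open>The dual problem\<close>

text \<open>\<open>R\<close> bounds the transport cost between \<open>X\<close> and
  \<open>Y\<close>; it will bound the transforms of normalised competitors. \<open>c\<close>
  converts \<nu>-integrals into Lebesgue mass.\<close>

locale dual_problem =
  fixes X Y :: "'a::euclidean_space set" and \<mu> \<nu> :: "'a measure" and g :: "'a \<Rightarrow> ennreal"
    and c R :: real
  assumes open_X: "open X" and open_Y: "open Y"
    and \<mu>: "P_on X \<mu>" and \<nu>: "P_on Y \<nu>"
    and g_meas [measurable]: "g \<in> borel_measurable borel" and \<nu>_eq: "\<nu> = density lborel g"
    and c_pos: "c > 0" and g_ge: "\<And>y. y \<in> Y \<Longrightarrow> ennreal c \<le> g y"
    and dist_le: "\<And>x y. x \<in> X \<Longrightarrow> y \<in> Y \<Longrightarrow> (norm (x - y))\<^sup>2 \<le> R"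
begin

definition J :: "('a \<Rightarrow> real) \<Rightarrow> real" where
  "J \<psi> = (\<integral>x\<in>X. Q2 Y \<psi> x \<partial>\<mu>) - (\<integral>y\<in>Y. \<psi> y \<partial>\<nu>)"

sublocale \<mu>: prob_space \<mu> using \<mu> by (simp add: P_on_def)
sublocale \<nu>: prob_space \<nu> using \<nu> by (simp add: P_on_def)

lemma sets_\<mu> [simp, measurable_cong]: "sets \<mu> = sets borel"
  using \<mu> by (simp add: P_on_def)

lemma sets_\<nu> [simp, measurable_cong]: "sets \<nu> = sets borel"
  using \<nu> by (simp add: P_on_def)

lemma X_borel [measurable]: "X \<in> sets borel" using open_X by simp
lemma Y_borel [measurable]: "Y \<in> sets borel" using open_Y by simp

lemma measure_X: "measure \<mu> X = 1"
  using \<mu> by (simp add: P_on_def measure_def)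

lemma measure_Y: "measure \<nu> Y = 1"
  using \<nu> by (simp add: P_on_def measure_def)

lemma Y_nonempty: "Y \<noteq> {}"
  using measure_Y by auto

lemma X_nonempty: "X \<noteq> {}"
  using measure_X by auto

lemma R_nonneg: "R \<ge> 0"
proof -
  obtain x y where "x \<in> X" "y \<in> Y" using X_nonempty Y_nonempty by auto
  then show ?thesis using dist_le[of x y] zero_le_power2[of "norm (x - y)"] by linarith
qed

lemma set_integral_X_const: "(\<integral>x\<in>X. (k::real) \<partial>\<mu>) = k"
  by (simp add: set_lebesgue_integral_def measure_X)

lemma set_integral_Y_const: "(\<integral>y\<in>Y. (k::real) \<partial>\<nu>) = k"
  by (simp add: set_lebesgue_integral_def measure_Y)

lemma set_integrable_X_const: "set_integrable \<mu> X (\<lambda>_. k::real)"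
  unfolding set_integrable_def
  by (rule \<mu>.integrable_const_bound[where B="\<bar>k\<bar>"]) (auto split: split_indicator)

lemma set_integrable_Y_const: "set_integrable \<nu> Y (\<lambda>_. k::real)"
  unfolding set_integrable_def
  by (rule \<nu>.integrable_const_bound[where B="\<bar>k\<bar>"]) (auto split: split_indicator)

lemma set_integrable_Q2:
  assumes b: "\<And>y. y \<in> Y \<Longrightarrow> b \<le> \<psi> y"
  shows "set_integrable \<mu> X (Q2 Y \<psi>)"
proof -
  obtain y0 where y0: "y0 \<in> Y" using Y_nonempty by auto
  have [measurable]: "Q2 Y \<psi> \<in> borel_measurable borel"
    by (rule measurable_Q2[OF Y_nonempty b])
  have "\<bar>Q2 Y \<psi> x\<bar> \<le> \<bar>b\<bar> + \<bar>\<psi> y0 + R\<bar>" if "x \<in> X" for x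
  proof -
    have "b \<le> \<psi> y + (norm (x - y))\<^sup>2" if "y \<in> Y" for y
      using b[OF that] by (simp add: add_increasing2)
    then have "\<not> Q2 Y \<psi> x < b"
      using Q2_less_iff[of Y b \<psi> x b] Y_nonempty b by (auto simp: not_less)
    moreover have "Q2 Y \<psi> x \<le> \<psi> y0 + R"
      using Q2_le[of Y b \<psi> y0 x] b y0 dist_le[OF that y0] by fastforce
    ultimately show ?thesis by linarith
  qed
  then have "norm (indicator X x *\<^sub>R Q2 Y \<psi> x) \<le> \<bar>b\<bar> + \<bar>\<psi> y0 + R\<bar>" for x
    by (auto simp: indicator_def)
  then show ?thesis
    unfolding set_integrable_def by (intro \<mu>.integrable_const_bound AE_I2) auto
qed

lemma nn_integral_Q2:
  assumes nn: "\<And>y. y \<in> Y \<Longrightarrow> 0 \<le> \<psi> y"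
  shows "(\<integral>\<^sup>+x. ennreal (indicator X x * Q2 Y \<psi> x) \<partial>\<mu>) = ennreal (\<integral>x\<in>X. Q2 Y \<psi> x \<partial>\<mu>)"
  using nn_integral_eq_integral[OF set_integrable_Q2[unfolded set_integrable_def, OF nn]]
    Q2_nonneg[OF Y_nonempty nn]
  by (simp add: set_lebesgue_integral_def)

lemma nn_integral_Y:
  assumes nn: "\<And>y. y \<in> Y \<Longrightarrow> 0 \<le> \<psi> y" and int: "set_integrable \<nu> Y \<psi>"
  shows "(\<integral>\<^sup>+y. ennreal (indicator Y y * \<psi> y) \<partial>\<nu>) = ennreal (\<integral>y\<in>Y. \<psi> y \<partial>\<nu>)"
proof -
  have "AE y in \<nu>. 0 \<le> indicator Y y * \<psi> y" using nn by (auto simp: indicator_def)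
  with nn_integral_eq_integral[OF int[unfolded set_integrable_def]] show ?thesis
    by (simp add: set_lebesgue_integral_def)
qed

lemma nn_integral_\<nu>: "f \<in> borel_measurable borel \<Longrightarrow> (\<integral>\<^sup>+y. f y \<partial>\<nu>) = (\<integral>\<^sup>+y. f y * g y \<partial>lborel)"
  unfolding \<nu>_eq by (subst nn_integral_density) (auto simp: mult.commute)

lemma Cb_on_measurable:
  "Cb_on Y \<psi> \<Longrightarrow> (\<lambda>y. indicator Y y * \<psi> y) \<in> borel_measurable borel"
  using borel_measurable_continuous_on_indicator[of Y \<psi>] by (simp add: Cb_on_def)

lemma Cb_on_integrable:
  assumes "Cb_on Y \<psi>"
  shows "set_integrable \<nu> Y \<psi>"
proof -
  obtain M where M: "\<And>y. y \<in> Y \<Longrightarrow> \<bar>\<psi> y\<bar> \<le> M"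
    using assms by (auto simp: Cb_on_def bounded_iff)
  obtain y0 where "y0 \<in> Y" using Y_nonempty by auto
  then have "M \<ge> 0" using M[of y0] by simp
  with M have "norm (indicator Y y *\<^sub>R \<psi> y) \<le> M" for y
    by (auto simp: indicator_def)
  then show ?thesis
    unfolding set_integrable_def using Cb_on_measurable[OF assms]
    by (intro \<nu>.integrable_const_bound AE_I2) (auto simp: measurable_cong_sets[OF sets_\<nu> refl])
qed

text \<open>Subtracting the infimum shifts both integrals in \<open>J\<close> equally, as \<mu> and
  \<nu> are probabilities carried by \<open>X\<close> and \<open>Y\<close>. Points where the shifted
  function is nearly 0 then show that its transform is at most the maximal cost
  \<open>R\<close>.\<close>

lemma normalized_competitor:
  assumes sub: "subharmonic_on Y \<psi>" and Cb: "Cb_on Y \<psi>"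
  obtains \<phi> where "subharmonic_on Y \<phi>" "Cb_on Y \<phi>" "\<And>y. y \<in> Y \<Longrightarrow> 0 \<le> \<phi> y"
    "\<And>x. x \<in> X \<Longrightarrow> Q2 Y \<phi> x \<le> R" "J \<phi> = J \<psi>"
proof -
  define m where "m = Inf (\<psi> ` Y)"
  have bdd: "bdd_below (\<psi> ` Y)"
    using Cb by (auto simp: Cb_on_def intro: bounded_imp_bdd_below)
  have m: "m \<le> \<psi> y" if "y \<in> Y" for y
    unfolding m_def using bdd that by (intro cInf_lower) auto
  define \<phi> where "\<phi> = (\<lambda>y. \<psi> y - m)"
  show thesis
  proof (rule that[of \<phi>])
    show "subharmonic_on Y \<phi>" unfolding \<phi>_def by (rule subharmonic_on_diff_const[OF sub])
    have "bounded ((\<lambda>_. m) ` Y)" by (rule bounded_subset[of "{m}"]) auto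
    then show "Cb_on Y \<phi>"
      using Cb unfolding Cb_on_def \<phi>_def
      by (auto intro!: continuous_intros bounded_minus_comp)
    show \<phi>_nonneg: "0 \<le> \<phi> y" if "y \<in> Y" for y using m[OF that] by (simp add: \<phi>_def)
    show "Q2 Y \<phi> x \<le> R" if x: "x \<in> X" for x
    proof (rule field_le_epsilon)
      fix e :: real assume "e > 0"
      then have "Inf (\<psi> ` Y) < m + e" by (simp add: m_def)
      then obtain y where y: "y \<in> Y" "\<psi> y < m + e"
        using cInf_lessD[of "\<psi> ` Y"] Y_nonempty by auto
      have "Q2 Y \<phi> x \<le> \<phi> y + (norm (x - y))\<^sup>2"
        by (rule Q2_le[OF \<phi>_nonneg y(1)])
      also have "\<dots> \<le> R + e" using y dist_le[OF x y(1)] by (simp add: \<phi>_def)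
      finally show "Q2 Y \<phi> x \<le> R + e" .
    qed
    have "Q2 Y \<phi> = (\<lambda>x. Q2 Y \<psi> x - m)"
      unfolding \<phi>_def by (intro ext Q2_diff_const[OF Y_nonempty m])
    moreover have "set_integrable \<mu> X (Q2 Y \<psi>)" by (rule set_integrable_Q2) (rule m)
    ultimately show "J \<phi> = J \<psi>"
      using set_integral_diff(2)[of \<mu> X "Q2 Y \<psi>", OF _ set_integrable_X_const, of m]
        set_integral_diff(2)[OF Cb_on_integrable[OF Cb] set_integrable_Y_const, of m]
      by (simp add: J_def set_integral_X_const set_integral_Y_const \<phi>_def)
  qed
qed

lemma J_le:
  assumes "\<And>y. y \<in> Y \<Longrightarrow> 0 \<le> \<phi> y" "\<And>x. x \<in> X \<Longrightarrow> Q2 Y \<phi> x \<le> R"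
  shows "(\<integral>x\<in>X. Q2 Y \<phi> x \<partial>\<mu>) \<le> R"
  using set_integral_mono[OF set_integrable_Q2[OF assms(1)] set_integrable_X_const assms(2)]
  by (simp add: set_integral_X_const)

lemma set_integral_nonneg_Y:
  fixes \<phi> :: "'a \<Rightarrow> real"
  assumes "\<And>y. y \<in> Y \<Longrightarrow> 0 \<le> \<phi> y"
  shows "0 \<le> (\<integral>y\<in>Y. \<phi> y \<partial>\<nu>)"
  unfolding set_lebesgue_integral_def
  by (intro integral_nonneg_AE AE_I2) (use assms in \<open>auto simp: indicator_def\<close>)

lemma Cb_on_zero: "Cb_on Y (\<lambda>_. 0 :: real)"
  by (auto simp: Cb_on_def intro!: boundedI)

text \<open>The supremum is finite: normalised competitors have value at most \<open>R\<close>, and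
  the zero function is a competitor.\<close>

lemma D2_real:
  obtains d where "D2 X Y \<mu> \<nu> = ereal d" "\<And>\<psi>. subharmonic_on Y \<psi> \<Longrightarrow> Cb_on Y \<psi> \<Longrightarrow> J \<psi> \<le> d"
    "\<And>e. e > 0 \<Longrightarrow> \<exists>\<psi>. subharmonic_on Y \<psi> \<and> Cb_on Y \<psi> \<and> d - e < J \<psi>"
proof -
  let ?S = "{\<psi>. subharmonic_on Y \<psi> \<and> Cb_on Y \<psi>}"
  have D2: "D2 X Y \<mu> \<nu> = (SUP \<psi>\<in>?S. ereal (J \<psi>))" by (simp add: D2_def J_def)
  have "J \<psi> \<le> R" if "\<psi> \<in> ?S" for \<psi>
  proof -
    from that have S: "subharmonic_on Y \<psi>" "Cb_on Y \<psi>" by auto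
    obtain \<phi> where \<phi>: "subharmonic_on Y \<phi>" "Cb_on Y \<phi>" "\<And>y. y \<in> Y \<Longrightarrow> 0 \<le> \<phi> y"
      "\<And>x. x \<in> X \<Longrightarrow> Q2 Y \<phi> x \<le> R" "J \<phi> = J \<psi>"
      by (rule normalized_competitor[OF S]) blast
    have "(\<integral>x\<in>X. Q2 Y \<phi> x \<partial>\<mu>) \<le> R" by (rule J_le) (fact \<phi>)+
    moreover have "0 \<le> (\<integral>y\<in>Y. \<phi> y \<partial>\<nu>)" by (rule set_integral_nonneg_Y) (fact \<phi>)
    ultimately show ?thesis using \<phi>(5) by (simp add: J_def)
  qed
  then have "D2 X Y \<mu> \<nu> \<le> ereal R"
    unfolding D2 by (intro SUP_least) simp
  moreover have "ereal (J (\<lambda>_. 0)) \<le> D2 X Y \<mu> \<nu>"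
    unfolding D2 using subharmonic_on_zero Cb_on_zero by (intro SUP_upper) simp
  ultimately obtain d where d: "D2 X Y \<mu> \<nu> = ereal d"
    by (cases "D2 X Y \<mu> \<nu>") auto
  show thesis
  proof (rule that[OF d])
    fix \<psi> assume "subharmonic_on Y \<psi>" "Cb_on Y \<psi>"
    then have "ereal (J \<psi>) \<le> D2 X Y \<mu> \<nu>" unfolding D2 by (intro SUP_upper) simp
    then show "J \<psi> \<le> d" by (simp add: d)
  next
    fix e :: real assume "e > 0"
    then have "ereal (d - e) < (SUP \<psi>\<in>?S. ereal (J \<psi>))" unfolding D2[symmetric] d by simp
    then show "\<exists>\<psi>. subharmonic_on Y \<psi> \<and> Cb_on Y \<psi> \<and> d - e < J \<psi>"
      unfolding less_SUP_iff by auto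
  qed
qed

lemma exists_subharmonic_ge:
  assumes d: "\<And>e. e > 0 \<Longrightarrow> \<exists>\<psi>. subharmonic_on Y \<psi> \<and> Cb_on Y \<psi> \<and> d - e < J \<psi>"
  obtains \<psi>0 where "subharmonic_on Y \<psi>0" "\<And>y. y \<in> Y \<Longrightarrow> 0 \<le> \<psi>0 y" "set_integrable \<nu> Y \<psi>0" "d \<le> J \<psi>0"
proof -
  have "\<exists>\<phi>. subharmonic_on Y \<phi> \<and> Cb_on Y \<phi> \<and> (\<forall>y\<in>Y. 0 \<le> \<phi> y) \<and> (\<forall>x\<in>X. Q2 Y \<phi> x \<le> R) \<and> d - rad n < J \<phi>" for n
  proof -
    obtain \<psi> where \<psi>: "subharmonic_on Y \<psi>" "Cb_on Y \<psi>" "d - rad n < J \<psi>"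
      using d[OF rad_pos[of n]] by blast
    show ?thesis by (rule normalized_competitor[OF \<psi>(1,2)]) (use \<psi>(3) in auto)
  qed
  then obtain \<phi> :: "nat \<Rightarrow> 'a \<Rightarrow> real" where \<phi>: "\<And>n. subharmonic_on Y (\<phi> n)" "\<And>n. Cb_on Y (\<phi> n)"
    "\<And>n y. y \<in> Y \<Longrightarrow> 0 \<le> \<phi> n y" "\<And>n x. x \<in> X \<Longrightarrow> Q2 Y (\<phi> n) x \<le> R" "\<And>n. d - rad n < J (\<phi> n)"
    by metis
  define a where "a n = (\<integral>x\<in>X. Q2 Y (\<phi> n) x \<partial>\<mu>)" for n
  define b where "b n = (\<integral>y\<in>Y. \<phi> n y \<partial>\<nu>)" for n
  have J: "J (\<phi> n) = a n - b n" for n by (simp add: J_def a_def b_def)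
  have a_le: "a n \<le> R" for n unfolding a_def by (rule J_le) (fact \<phi>)+
  have b_nonneg: "0 \<le> b n" for n unfolding b_def by (rule set_integral_nonneg_Y) (fact \<phi>)
  have rad_le: "rad n \<le> 1" for n by (simp add: rad_def inverse_le_1_iff)
  \<comment> \<open>From \<open>d - rad n < a n - b n\<close>, \<open>a n \<le> R\<close> and
    \<open>rad n \<le> 1\<close>.\<close>
  define C where "C = R - d + 1"
  have b_le: "b n \<le> C" for n
    using \<phi>(5)[of n] a_le[of n] rad_le[of n] by (simp add: J C_def)
  have C_nonneg: "C \<ge> 0" using b_le[of 0] b_nonneg[of 0] by linarith
  define p where "p n y = ennreal (indicator Y y * \<phi> n y)" for n y
  have p_meas [measurable]: "p n \<in> borel_measurable borel" for n
    unfolding p_def[abs_def] using Cb_on_measurable[OF \<phi>(2)] by (rule measurable_compose) simp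
  have p_\<nu>: "(\<integral>\<^sup>+y. p n y \<partial>\<nu>) = ennreal (b n)" for n
    unfolding p_def b_def by (rule nn_integral_Y[OF _ Cb_on_integrable[OF \<phi>(2)]]) (rule \<phi>(3))
  then have p_g: "(\<integral>\<^sup>+y. p n y * g y \<partial>lborel) = ennreal (b n)" for n
    by (simp add: nn_integral_\<nu>)
  \<comment> \<open>The density is at least \<open>c\<close> on \<open>Y\<close>, and
    \<open>p n\<close> vanishes elsewhere; hence the factor \<open>1 / c\<close> when passing from
    \<nu> to Lebesgue measure.\<close>
  have p_mass: "(\<integral>\<^sup>+y. p n y \<partial>lborel) \<le> ennreal (C / c)" for n
  proof -
    have "ennreal c * (\<integral>\<^sup>+y. p n y \<partial>lborel) = (\<integral>\<^sup>+y. ennreal c * p n y \<partial>lborel)"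
      by (rule nn_integral_cmult[symmetric]) measurable
    also have "\<dots> \<le> (\<integral>\<^sup>+y. p n y * g y \<partial>lborel)"
    proof (rule nn_integral_mono)
      fix y show "ennreal c * p n y \<le> p n y * g y"
        using g_ge[of y] by (cases "y \<in> Y") (auto simp: p_def mult.commute intro: mult_right_mono)
    qed
    also have "\<dots> \<le> ennreal C" unfolding p_g by (rule ennreal_leI[OF b_le])
    also have "\<dots> = ennreal c * ennreal (C / c)"
      using c_pos C_nonneg by (simp flip: ennreal_mult)
    finally show ?thesis using c_pos by (simp add: ennreal_mult_le_mult_iff)
  qed
  interpret S: submean_sequence Y p "C / c"
  proof
    fix n x r assume r: "(0::real) < r" "cball x r \<subseteq> Y"
    then have *: "set_integrable lborel (ball 0 1) (sphere_fun (\<phi> n) x r)"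
      "\<phi> n x \<le> (\<integral>z\<in>ball 0 1. sphere_fun (\<phi> n) x r z \<partial>lborel) / measure lborel (ball (0::'a) 1)"
      using \<phi>(1)[of n] by (auto simp: subharmonic_on_def)
    have "x \<in> Y" using r by auto
    then have "p n x = ennreal (\<phi> n x)" by (simp add: p_def)
    also have "\<dots> \<le> ennreal ((\<integral>z\<in>ball 0 1. sphere_fun (\<phi> n) x r z \<partial>lborel) / measure lborel (ball (0::'a) 1))"
      by (rule ennreal_leI[OF *(2)])
    also have "\<dots> = smean r (p n) x"
      using r by (intro smean_eq_sphere_mean(1)[symmetric] p_meas *(1)) (auto simp: p_def subset_iff intro!: \<phi>(3))
    finally show "p n x \<le> smean r (p n) x" .
  qed (use p_mass C_nonneg c_pos open_Y in \<open>auto simp: p_def[of _ y for y]\<close>)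
  obtain k V where k: "strict_mono (k :: nat \<Rightarrow> nat)" and V_meas [measurable]: "V \<in> borel_measurable borel"
    and V_finite: "\<And>x. x \<in> Y \<Longrightarrow> V x < top"
    and V_bounded: "\<And>K. compact K \<Longrightarrow> K \<subseteq> Y \<Longrightarrow> \<exists>M::real. \<forall>x\<in>K. V x \<le> ennreal M"
    and V_usc: "\<And>x a. x \<in> Y \<Longrightarrow> V x < a \<Longrightarrow> \<exists>s>0. \<forall>q. dist x q < s \<longrightarrow> V q < a"
    and V_submean: "\<And>x r. r > 0 \<Longrightarrow> cball x r \<subseteq> Y \<Longrightarrow> V x \<le> smean r V x"
    and V_limsup: "\<And>x. x \<in> Y \<Longrightarrow> limsup (\<lambda>n. p (k n) x) \<le> V x"
    and V_integral: "\<And>h. h \<in> borel_measurable borel \<Longrightarrow>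
      (\<integral>\<^sup>+y. V y * (h y * indicator Y y) \<partial>lborel) \<le> liminf (\<lambda>n. \<integral>\<^sup>+y. p (k n) y * h y \<partial>lborel)"
    by (rule S.compactness) blast
  define \<psi>0 where "\<psi>0 y = enn2real (V y)" for y
  have V_eq: "V y = ennreal (\<psi>0 y)" if "y \<in> Y" for y
    using V_finite[OF that] by (simp add: \<psi>0_def)
  have \<psi>0_nonneg: "0 \<le> \<psi>0 y" for y by (simp add: \<psi>0_def)
  have [measurable]: "\<psi>0 \<in> borel_measurable borel" unfolding \<psi>0_def[abs_def] by measurable
  have sub: "subharmonic_on Y \<psi>0"
    unfolding subharmonic_on_def
  proof (intro conjI allI impI)
    show "usc_on Y \<psi>0"
      unfolding usc_on_def
    proof (intro ballI allI impI)
      fix x and e :: real assume x: "x \<in> Y" and e: "e > 0"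
      then have "V x < ennreal (\<psi>0 x + e)" by (simp add: V_eq \<psi>0_nonneg ennreal_less_iff)
      then obtain s where s: "s > 0" "\<And>q. dist x q < s \<Longrightarrow> V q < ennreal (\<psi>0 x + e)"
        using V_usc[OF x] by blast
      have "\<psi>0 q < \<psi>0 x + e" if "q \<in> Y" "dist x q < s" for q
        using s(2)[OF that(2)] by (simp add: V_eq[OF that(1)] \<psi>0_nonneg ennreal_less_iff)
      then show "\<forall>\<^sub>F y in at x within Y. \<psi>0 y < \<psi>0 x + e"
        using s(1) unfolding eventually_at by (metis dist_commute)
    qed
  next
    fix x r assume "0 < r \<and> cball x r \<subseteq> Y"
    then have r: "0 < r" "cball x r \<subseteq> Y" by auto
    \<comment> \<open>Local boundedness of \<open>V\<close> supplies the integrability over spheres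
      that \<open>subharmonic_on\<close> demands besides the inequality.\<close>
    obtain M :: real where M: "\<And>y. y \<in> cball x r \<Longrightarrow> V y \<le> ennreal M"
      using V_bounded[OF compact_cball r(2)] by blast
    have bd: "\<bar>\<psi>0 y\<bar> \<le> \<bar>M\<bar>" if "y \<in> cball x r" for y
    proof -
      have "y \<in> Y" using that r(2) by auto
      then have "ennreal (\<psi>0 y) \<le> ennreal \<bar>M\<bar>"
        using M[OF that] order_trans[OF _ ennreal_leI[OF abs_ge_self]] by (simp add: V_eq)
      then show ?thesis by (simp add: ennreal_le_iff \<psi>0_nonneg)
    qed
    have mem: "x + r *\<^sub>R sgn z \<in> cball x r" for z :: 'a
      using r by (simp add: dist_norm norm_sgn)
    have sf: "sphere_fun \<psi>0 x r = (\<lambda>z. \<psi>0 (x + r *\<^sub>R sgn z))"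
      by (simp add: sphere_fun_def sgn_div_norm)
    have "integrable lborel (\<lambda>z. indicator (ball 0 1) z *\<^sub>R sphere_fun \<psi>0 x r z)"
    proof (rule Bochner_Integration.integrable_bound[where f="\<lambda>z. \<bar>M\<bar> * indicator (ball 0 1) z"])
      show "integrable lborel (\<lambda>z::'a. \<bar>M\<bar> * indicator (ball 0 1) z)"
        using emeasure_lborel_ball_finite[of "0::'a" 1] by simp
    qed (use bd[OF mem] in \<open>auto simp: sf indicator_def\<close>)
    then show int: "set_integrable lborel (ball 0 1) (sphere_fun \<psi>0 x r)"
      by (simp add: set_integrable_def)
    have eq: "V y = ennreal (\<psi>0 y)" if "y \<in> cball x r" for y using that r(2) V_eq by blast
    have sm: "smean r V x = ennreal ((\<integral>z\<in>ball 0 1. sphere_fun \<psi>0 x r z \<partial>lborel) / measure lborel (ball (0::'a) 1))"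
      "0 \<le> (\<integral>z\<in>ball 0 1. sphere_fun \<psi>0 x r z \<partial>lborel)"
      by (rule smean_eq_sphere_mean[OF V_meas less_imp_le[OF r(1)]]; use eq \<psi>0_nonneg int in blast)+
    have "ennreal (\<psi>0 x) \<le> smean r V x" using V_submean[OF r] eq[of x] r(1) by simp
    then show "\<psi>0 x \<le> (\<integral>z\<in>ball 0 1. sphere_fun \<psi>0 x r z \<partial>lborel) / measure lborel (ball (0::'a) 1)"
      using sm(2) by (simp add: sm(1) ennreal_le_iff)
  qed
  have "(\<integral>\<^sup>+y. ennreal (indicator Y y * \<psi>0 y) \<partial>\<nu>) = (\<integral>\<^sup>+y. V y * (g y * indicator Y y) \<partial>lborel)"
    by (subst nn_integral_\<nu>) (auto intro!: nn_integral_cong simp: V_eq mult.commute split: split_indicator)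
  also have "\<dots> \<le> liminf (\<lambda>n. ennreal (b (k n)))"
    using V_integral[OF g_meas] by (simp add: p_g)
  finally have \<psi>0_liminf: "(\<integral>\<^sup>+y. ennreal (indicator Y y * \<psi>0 y) \<partial>\<nu>) \<le> liminf (\<lambda>n. ennreal (b (k n)))" .
  also have "\<dots> \<le> limsup (\<lambda>n. ennreal (b (k n)))" by (rule Liminf_le_Limsup) simp
  also have "\<dots> \<le> ennreal C" by (intro Limsup_bounded always_eventually allI ennreal_leI b_le)
  finally have fin: "(\<integral>\<^sup>+y. ennreal (indicator Y y * \<psi>0 y) \<partial>\<nu>) < \<infinity>"
    by (simp add: le_less_trans)
  have int0: "set_integrable \<nu> Y \<psi>0"
    unfolding set_integrable_def
  proof (rule integrableI_nonneg)
    show "AE y in \<nu>. 0 \<le> indicator Y y *\<^sub>R \<psi>0 y" using \<psi>0_nonneg by (auto simp: indicator_def)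
  qed (use fin in auto)
  define \<alpha> where "\<alpha> = (\<integral>x\<in>X. Q2 Y \<psi>0 x \<partial>\<mu>)"
  define \<beta> where "\<beta> = (\<integral>y\<in>Y. \<psi>0 y \<partial>\<nu>)"
  have \<beta>: "ennreal \<beta> \<le> liminf (\<lambda>n. ennreal (b (k n)))"
    using \<psi>0_liminf nn_integral_Y[OF \<psi>0_nonneg int0] by (simp add: \<beta>_def)
  \<comment> \<open>A near-minimiser \<open>y\<close> for \<open>\<psi>0\<close> is tested in every
    approximating transform, so only the limsup at the single point \<open>y\<close> enters.\<close>
  have Q2_limsup: "limsup (\<lambda>n. ennreal (Q2 Y (\<phi> (k n)) x)) \<le> ennreal (Q2 Y \<psi>0 x)" for x
  proof (rule ennreal_le_epsilon)
    fix e :: real assume e: "0 < e"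
    then obtain y where y: "y \<in> Y" "\<psi>0 y + (norm (x - y))\<^sup>2 < Q2 Y \<psi>0 x + e"
      using Q2_less_iff[of Y 0 \<psi>0 x "Q2 Y \<psi>0 x + e"] Y_nonempty \<psi>0_nonneg by auto
    have "limsup (\<lambda>n. ennreal (Q2 Y (\<phi> (k n)) x)) \<le> limsup (\<lambda>n. p (k n) y) + ennreal ((norm (x - y))\<^sup>2)"
    proof (rule limsup_le_limsup_plus)
      fix n
      have "Q2 Y (\<phi> (k n)) x \<le> \<phi> (k n) y + (norm (x - y))\<^sup>2"
        using Q2_le[of Y 0 "\<phi> (k n)" y x] \<phi>(3) y(1) by blast
      then show "ennreal (Q2 Y (\<phi> (k n)) x) \<le> p (k n) y + ennreal ((norm (x - y))\<^sup>2)"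
        using y(1) \<phi>(3)[OF y(1)] by (simp add: p_def ennreal_leI flip: ennreal_plus)
    qed
    also have "\<dots> \<le> ennreal (\<psi>0 y) + ennreal ((norm (x - y))\<^sup>2)"
      using V_limsup[OF y(1)] by (simp add: V_eq[OF y(1)] add_right_mono)
    also have "\<dots> \<le> ennreal (Q2 Y \<psi>0 x) + ennreal e"
      using y(2) e Q2_nonneg[of Y \<psi>0 x] Y_nonempty \<psi>0_nonneg
      by (simp add: ennreal_leI flip: ennreal_plus)
    finally show "limsup (\<lambda>n. ennreal (Q2 Y (\<phi> (k n)) x)) \<le> ennreal (Q2 Y \<psi>0 x) + ennreal e" .
  qed
  have [measurable]: "Q2 Y (\<phi> n) \<in> borel_measurable borel" for n
    by (rule measurable_Q2[OF Y_nonempty]) (rule \<phi>(3))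
  have a_nn: "(\<integral>\<^sup>+x. ennreal (indicator X x * Q2 Y (\<phi> n) x) \<partial>\<mu>) = ennreal (a n)" for n
    unfolding a_def by (rule nn_integral_Q2) (rule \<phi>(3))
  have "limsup (\<lambda>n. ennreal (a (k n))) = limsup (\<lambda>n. \<integral>\<^sup>+x. ennreal (indicator X x * Q2 Y (\<phi> (k n)) x) \<partial>\<mu>)"
    by (simp add: a_nn)
  also have "\<dots> \<le> (\<integral>\<^sup>+x. limsup (\<lambda>n. ennreal (indicator X x * Q2 Y (\<phi> (k n)) x)) \<partial>\<mu>)"
  \<comment> \<open>The uniform majorant \<open>R\<close> comes from normalising the infima to
    0.\<close>
  proof (rule nn_integral_limsup[where w="\<lambda>_. ennreal R"])
    show "AE x in \<mu>. ennreal (indicator X x * Q2 Y (\<phi> (k n)) x) \<le> ennreal R" for n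
      using \<phi>(4) R_nonneg by (auto simp: indicator_def intro!: ennreal_leI)
  qed (auto simp: \<mu>.emeasure_space_1)
  also have "\<dots> \<le> (\<integral>\<^sup>+x. ennreal (indicator X x * Q2 Y \<psi>0 x) \<partial>\<mu>)"
    using Q2_limsup by (intro nn_integral_mono) (auto simp: Limsup_const split: split_indicator)
  also have "\<dots> = ennreal \<alpha>"
    unfolding \<alpha>_def by (rule nn_integral_Q2) (rule \<psi>0_nonneg)
  finally have \<alpha>: "limsup (\<lambda>n. ennreal (a (k n))) \<le> ennreal \<alpha>" .
  have a_nonneg: "0 \<le> a n" for n
    unfolding a_def set_lebesgue_integral_def
    by (intro integral_nonneg_AE AE_I2) (simp add: Q2_nonneg Y_nonempty \<phi>(3))
  have \<alpha>_nonneg: "\<alpha> \<ge> 0"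
    unfolding \<alpha>_def set_lebesgue_integral_def
    by (intro integral_nonneg_AE AE_I2) (simp add: Q2_nonneg Y_nonempty \<psi>0_nonneg)
  have "d \<le> \<alpha> - \<beta>"
  proof (rule field_le_epsilon)
    fix e :: real assume e: "0 < e"
    \<comment> \<open>One third each for the limsup of \<open>a\<close>, the liminf of
      \<open>b\<close> and the optimality error \<open>rad\<close>.\<close>
    define e' where "e' = e / 3"
    have e': "e' > 0" using e by (simp add: e'_def)
    have "ennreal \<alpha> < ennreal (\<alpha> + e')" using \<alpha>_nonneg e' by (simp add: ennreal_less_iff)
    then have 1: "\<forall>\<^sub>F n in sequentially. ennreal (a (k n)) < ennreal (\<alpha> + e')"
      using \<alpha> by (intro Limsup_lessD) (rule le_less_trans)
    have 2: "\<forall>\<^sub>F n in sequentially. \<beta> - e' < b (k n)"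
    \<comment> \<open>\<open>ennreal\<close> truncates negative numbers to 0, so a negative
      threshold is compared directly with \<open>b (k n) \<ge> 0\<close>.\<close>
    proof (cases "\<beta> - e' < 0")
      case True
      then show ?thesis using b_nonneg by (intro always_eventually allI) (rule less_le_trans)
    next
      case False
      then have "ennreal (\<beta> - e') < ennreal \<beta>" using e' by (simp add: ennreal_less_iff)
      then have "\<forall>\<^sub>F n in sequentially. ennreal (\<beta> - e') < ennreal (b (k n))"
        using \<beta> by (intro less_LiminfD) (rule less_le_trans)
      then show ?thesis using False by (simp add: ennreal_less_iff)
    qed
    from 1 2 eventually_rad_less[OF e'] have "\<forall>\<^sub>F n in sequentially. d \<le> \<alpha> - \<beta> + e"
    proof eventually_elim
      case (elim n)
      have "a (k n) < \<alpha> + e'"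
        using elim(1) a_nonneg[of "k n"] by (simp add: ennreal_less_iff)
      moreover have "rad (k n) \<le> rad n"
        using seq_suble[OF k, of n] by (simp add: rad_def)
      ultimately show ?case
        using elim(2,3) \<phi>(5)[of "k n"] by (simp add: J e'_def)
    qed
    then show "d \<le> \<alpha> - \<beta> + e" by simp
  qed
  then have "d \<le> J \<psi>0" by (simp add: J_def \<alpha>_def \<beta>_def)
  with sub \<psi>0_nonneg int0 that show thesis by blast
qed

end

text \<open>\<open>\<psi>\<close> may be unbounded, so there need be no uniform convergence in
  \<open>y\<close>. The upper estimate tests one near-minimiser; the lower one uses that the
  transform at scale \<open>v \<ge> 0\<close> is at least \<open>s\<close> times that at scale
  \<open>t\<close> whenever \<open>0 \<le> s \<le> 1\<close> and
  \<open>s * t \<le> v\<close>.\<close>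

lemma tendsto_Q2_scale:
  assumes Y: "Y \<noteq> {}" and nn: "\<And>y. y \<in> Y \<Longrightarrow> 0 \<le> \<psi> y"
    and u: "\<And>n. 0 \<le> u n" "0 \<le> t" "u \<longlonglongrightarrow> t"
  shows "(\<lambda>n. Q2 Y (\<lambda>y. u n * \<psi> y) x) \<longlonglongrightarrow> Q2 Y (\<lambda>y. t * \<psi> y) x"
proof (rule order_tendstoI)
  let ?q = "\<lambda>s. Q2 Y (\<lambda>y. s * \<psi> y) x"
  have q_nonneg: "0 \<le> ?q s" if "0 \<le> s" for s
    using that nn by (intro Q2_nonneg Y) auto
  have q_le: "?q s \<le> s * \<psi> y + (norm (x - y))\<^sup>2" if "0 \<le> s" "y \<in> Y" for s y
    using that nn by (intro Q2_le[of Y 0]) auto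
  {
    fix l assume l: "l < ?q t"
    show "\<forall>\<^sub>F n in sequentially. l < ?q (u n)"
    \<comment> \<open>Dividing by \<open>t\<close> is impossible at scale 0, where the transform is
      minimal because \<open>\<psi>\<close> is nonnegative.\<close>
    proof (cases "t = 0")
      case True
      have "?q t \<le> ?q (u n)" for n
        unfolding Q2_def[of Y "\<lambda>y. u n * \<psi> y"]
      proof (rule cINF_greatest[OF Y])
        fix y assume "y \<in> Y"
        then show "?q t \<le> u n * \<psi> y + (norm (x - y))\<^sup>2"
          using q_le[of t y] u nn[of y] True by (simp add: add_increasing)
      qed
      with l show ?thesis by (intro always_eventually allI) (rule less_le_trans)
    next
      case False
      then have t: "t > 0" using u(2) by simp
      have "(\<lambda>n. (1 - \<bar>u n - t\<bar> / t) * ?q t) \<longlonglongrightarrow> (1 - \<bar>t - t\<bar> / t) * ?q t"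
        using t by (intro tendsto_intros u(3)) auto
      then have "\<forall>\<^sub>F n in sequentially. l < (1 - \<bar>u n - t\<bar> / t) * ?q t"
        using l by (intro order_tendstoD(1)) auto
      moreover have "(1 - \<bar>u n - t\<bar> / t) * ?q t \<le> ?q (u n)" for n
      proof (cases "1 - \<bar>u n - t\<bar> / t < 0")
        case True
        then have "(1 - \<bar>u n - t\<bar> / t) * ?q t \<le> 0"
          using q_nonneg[of t] t by (intro mult_nonpos_nonneg) auto
        with q_nonneg[OF u(1), of n] show ?thesis by linarith
      next
        case False
        \<comment> \<open>Chosen so that \<open>s * t = t - \<bar>u n - t\<bar> \<le> u n\<close>
          and \<open>s \<le> 1\<close>, while it tends to 1.\<close>
        define s where "s = 1 - \<bar>u n - t\<bar> / t"
        have s: "0 \<le> s" "s \<le> 1" "s * t \<le> u n"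
          using False t by (auto simp: s_def field_simps abs_if)
        have "s * ?q t \<le> ?q (u n)"
          unfolding Q2_def[of Y "\<lambda>y. u n * \<psi> y"]
        proof (rule cINF_greatest[OF Y])
          fix y assume y: "y \<in> Y"
          have "s * ?q t \<le> s * (t * \<psi> y + (norm (x - y))\<^sup>2)"
            using q_le[OF u(2) y] s(1) by (rule mult_left_mono)
          also have "\<dots> = (s * t) * \<psi> y + s * (norm (x - y))\<^sup>2" by (simp add: algebra_simps)
          also have "\<dots> \<le> u n * \<psi> y + 1 * (norm (x - y))\<^sup>2"
            using s nn[OF y] by (intro add_mono mult_right_mono) auto
          finally show "s * ?q t \<le> u n * \<psi> y + (norm (x - y))\<^sup>2" by simp
        qed
        then show ?thesis by (simp add: s_def)
      qed
      ultimately show ?thesis by (blast intro: eventually_mono less_le_trans)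
    qed
  next
    fix l assume "?q t < l"
    then obtain y where y: "y \<in> Y" "t * \<psi> y + (norm (x - y))\<^sup>2 < l"
      using Q2_less_iff[of Y 0 "\<lambda>y. t * \<psi> y" x l] Y nn u(2) by auto
    have "(\<lambda>n. u n * \<psi> y + (norm (x - y))\<^sup>2) \<longlonglongrightarrow> t * \<psi> y + (norm (x - y))\<^sup>2"
      by (intro tendsto_intros u(3))
    then have "\<forall>\<^sub>F n in sequentially. u n * \<psi> y + (norm (x - y))\<^sup>2 < l"
      using y(2) by (rule order_tendstoD(2))
    then show "\<forall>\<^sub>F n in sequentially. ?q (u n) < l"
      by eventually_elim (rule le_less_trans[OF q_le[OF u(1) y(1)]])
  }
qed

context dual_problem
begin

text \<open>Dominated convergence: testing the transforms at one fixed \<open>y0\<close> bounds them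
  by \<open>\<psi> y0 + R\<close> for all scales up to 1. The \<nu>-integral is linear in the
  scale.\<close>

lemma continuous_on_J_scale:
  assumes nn: "\<And>y. y \<in> Y \<Longrightarrow> 0 \<le> \<psi> y" and int: "set_integrable \<nu> Y \<psi>"
  shows "continuous_on {0..1} (\<lambda>t. J (\<lambda>y. t * \<psi> y))"
proof -
  obtain y0 where y0: "y0 \<in> Y" using Y_nonempty by auto
  have meas: "Q2 Y (\<lambda>y. s * \<psi> y) \<in> borel_measurable borel" if "0 \<le> s" for s
    using that nn by (intro measurable_Q2[of Y 0] Y_nonempty) auto
  have bd: "\<bar>indicator X x * Q2 Y (\<lambda>y. s * \<psi> y) x\<bar> \<le> \<psi> y0 + R" if s: "s \<in> {0..1}" for s x
  proof (cases "x \<in> X")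
    case True
    have "Q2 Y (\<lambda>y. s * \<psi> y) x \<le> s * \<psi> y0 + (norm (x - y0))\<^sup>2"
      using s nn y0 by (intro Q2_le[of Y 0]) auto
    also have "\<dots> \<le> 1 * \<psi> y0 + R"
      using s nn[OF y0] dist_le[OF True y0] by (intro add_mono mult_right_mono) auto
    finally show ?thesis
      using True Q2_nonneg[of Y "\<lambda>y. s * \<psi> y" x] Y_nonempty nn s by simp
  qed (use nn[OF y0] R_nonneg in simp)
  have "continuous_on {0..1} (\<lambda>t. \<integral>x\<in>X. Q2 Y (\<lambda>y. t * \<psi> y) x \<partial>\<mu>)"
  proof (rule continuous_on_sequentiallyI)
    fix u :: "nat \<Rightarrow> real" and t assume u: "\<forall>n. u n \<in> {0..1}" "t \<in> {0..1}" "u \<longlonglongrightarrow> t"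
    have u': "0 \<le> u n" "0 \<le> t" for n using u by auto
    have [measurable]: "Q2 Y (\<lambda>y. u n * \<psi> y) \<in> borel_measurable borel"
      "Q2 Y (\<lambda>y. t * \<psi> y) \<in> borel_measurable borel" for n
      using meas u' by auto
    show "(\<lambda>n. \<integral>x\<in>X. Q2 Y (\<lambda>y. u n * \<psi> y) x \<partial>\<mu>) \<longlonglongrightarrow> (\<integral>x\<in>X. Q2 Y (\<lambda>y. t * \<psi> y) x \<partial>\<mu>)"
      unfolding set_lebesgue_integral_def real_scaleR_def
    proof (rule integral_dominated_convergence[where w="\<lambda>_. \<psi> y0 + R"])
      show "AE x in \<mu>. (\<lambda>n. indicator X x * Q2 Y (\<lambda>y. u n * \<psi> y) x) \<longlonglongrightarrow> indicator X x * Q2 Y (\<lambda>y. t * \<psi> y) x"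
        using u u' nn by (intro AE_I2 tendsto_intros tendsto_Q2_scale Y_nonempty) auto
      show "AE x in \<mu>. norm (indicator X x * Q2 Y (\<lambda>y. u n * \<psi> y) x) \<le> \<psi> y0 + R" for n
        using bd u(1) by (intro AE_I2) (simp only: real_norm_def)
    qed auto
  qed
  then have "continuous_on {0..1} (\<lambda>t. (\<integral>x\<in>X. Q2 Y (\<lambda>y. t * \<psi> y) x \<partial>\<mu>) - t * (\<integral>y\<in>Y. \<psi> y \<partial>\<nu>))"
    by (intro continuous_intros)
  then show ?thesis by (simp add: J_def)
qed

text \<open>An exact value gives the inequality and the equality of the theorem with one and the
  same function. Scaling by \<open>t \<ge> 0\<close> preserves subharmonicity, the lower bound and
  integrability.\<close>

lemma dual_attained:
  obtains \<psi>0 where "subharmonic_on Y \<psi>0" "bdd_below (\<psi>0 ` Y)" "set_integrable \<nu> Y \<psi>0"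
    "D2 X Y \<mu> \<nu> = ereal (J \<psi>0)"
proof -
  obtain d where d: "D2 X Y \<mu> \<nu> = ereal d"
    "\<And>\<psi>. subharmonic_on Y \<psi> \<Longrightarrow> Cb_on Y \<psi> \<Longrightarrow> J \<psi> \<le> d"
    "\<And>e. e > 0 \<Longrightarrow> \<exists>\<psi>. subharmonic_on Y \<psi> \<and> Cb_on Y \<psi> \<and> d - e < J \<psi>"
    by (rule D2_real) blast
  obtain \<psi>1 where \<psi>1: "subharmonic_on Y \<psi>1" "\<And>y. y \<in> Y \<Longrightarrow> 0 \<le> \<psi>1 y" "set_integrable \<nu> Y \<psi>1" "d \<le> J \<psi>1"
    by (rule exists_subharmonic_ge[OF d(3)]) blast+
  have "J (\<lambda>y. 0 * \<psi>1 y) \<le> d" using d(2)[OF subharmonic_on_zero Cb_on_zero] by simp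
  moreover have "d \<le> J (\<lambda>y. 1 * \<psi>1 y)" using \<psi>1(4) by simp
  moreover have "continuous_on {0..1} (\<lambda>t. J (\<lambda>y. t * \<psi>1 y))"
    by (rule continuous_on_J_scale) (fact \<psi>1)+
  ultimately obtain t where t: "0 \<le> t" "t \<le> 1" "J (\<lambda>y. t * \<psi>1 y) = d"
    using IVT'[of "\<lambda>t. J (\<lambda>y. t * \<psi>1 y)" 0 d 1] by auto
  show thesis
  proof (rule that)
    show "subharmonic_on Y (\<lambda>y. t * \<psi>1 y)" by (rule subharmonic_on_cmult[OF \<psi>1(1) t(1)])
    show "bdd_below ((\<lambda>y. t * \<psi>1 y) ` Y)" using t(1) \<psi>1(2) by (intro bdd_belowI2[of _ 0]) simp
    show "set_integrable \<nu> Y (\<lambda>y. t * \<psi>1 y)" using \<psi>1(3) by simp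
    show "D2 X Y \<mu> \<nu> = ereal (J (\<lambda>y. t * \<psi>1 y))" by (simp add: d(1) t(3))
  qed
qed

end

theorem mainTheorem16:
  fixes X Y :: "'a::euclidean_space set" and \<mu> \<nu> :: "'a measure" and g :: "'a \<Rightarrow> ennreal"
  assumes "bounded X" "convex X" "open X"
    and "bounded Y" "convex Y" "open Y"
    and "P_on X \<mu>"
    and "P_on Y \<nu>"
    and "g \<in> borel_measurable borel" "\<nu> = density lborel g"
    and "\<exists>c>0. \<forall>y\<in>Y. ennreal c \<le> g y"
  shows "\<exists>\<psi>0. subharmonic_on Y \<psi>0 \<and> bdd_below (\<psi>0 ` Y) \<and> set_integrable \<nu> Y \<psi>0 \<and>
     D2 X Y \<mu> \<nu> \<le> ereal ((\<integral>x\<in>X. Q2 Y \<psi>0 x \<partial>\<mu>) - (\<integral>y\<in>Y. \<psi>0 y \<partial>\<nu>)) \<and>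
     (\<forall>\<mu>b. \<mu>b \<in> Psh_le Y \<nu> \<and> (\<forall>\<eta>\<in>Psh_le Y \<nu>. T2 \<mu> \<mu>b \<le> T2 \<mu> \<eta>) \<and>
        set_integrable \<mu>b Y \<psi>0 \<and> (\<integral>y\<in>Y. \<psi>0 y \<partial>\<mu>b) \<le> (\<integral>y\<in>Y. \<psi>0 y \<partial>\<nu>) \<longrightarrow>
        D2 X Y \<mu> \<nu> = ereal ((\<integral>x\<in>X. Q2 Y \<psi>0 x \<partial>\<mu>) - (\<integral>y\<in>Y. \<psi>0 y \<partial>\<nu>)))"
proof -
  obtain c where c: "c > 0" "\<And>y. y \<in> Y \<Longrightarrow> ennreal c \<le> g y" using assms(11) by blast
  obtain a b where a: "\<And>x. x \<in> X \<Longrightarrow> norm x \<le> a" and b: "\<And>y. y \<in> Y \<Longrightarrow> norm y \<le> b"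
    using assms(1,4) unfolding bounded_iff by blast
  \<comment> \<open>\<open>a\<close> and \<open>b\<close> bound the norms on \<open>X\<close> and
    \<open>Y\<close>, so the triangle inequality gives the cost bound.\<close>
  interpret dual_problem X Y \<mu> \<nu> g c "(a + b)\<^sup>2"
  proof
    fix x y assume "x \<in> X" "y \<in> Y"
    then have "norm (x - y) \<le> a + b" using a b norm_triangle_ineq4[of x y] by force
    then show "(norm (x - y))\<^sup>2 \<le> (a + b)\<^sup>2" by (intro power_mono) auto
  qed (use assms c in auto)
  obtain \<psi>0 where "subharmonic_on Y \<psi>0" "bdd_below (\<psi>0 ` Y)" "set_integrable \<nu> Y \<psi>0"
    "D2 X Y \<mu> \<nu> = ereal (J \<psi>0)"
    by (rule dual_attained)
  then show ?thesis by (intro exI[of _ \<psi>0]) (simp add: J_def)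
qed

end
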